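(* Let $X$ be a connected square-tiled surface of genus at least $2$ and let $\alpha\in(0,1)$ be irrational. Then the square-tiled interval exchange transformation $T_\alpha$ associated with $X$ is rigid (with respect to normalized Lebesgue measure) if and only if $\alpha$ has unbounded partial quotients.
   Context: A square-tiled surface is obtained from finitely many unit squares labelled $1,\dots,d$ by gluing, by translations, the right side of square $i$ to the left side of square $\tau(i)$ and the top side of square $i$ to the bottom side of square $\sigma(i)$, where $\tau,\sigma$ are permutations of $\{1,\dots,d\}$. The surface is connected if and only if the group generated by $\tau$ and $\sigma$ acts transitively on $\{1,\dots,d\}$. A connected square-tiled surface has genus at least $2$ if and only if $\tau$ and $\sigma$ do not commute. For $\alpha\in(0,1)$, write $\alpha=\frac{1}{1+\tan\theta}$ with $\tan\theta>0$. The square-tiled interval exchange transformation $T_\alpha$ is the first return map of the linear flow in direction $\theta$ to the union of the diagonals of slope $-1$ of the squares, the length of each diagonal being normalized to $1$. Concretely, $T_\alpha$ acts on $[0,1[\times\{1,\dots,d\}$ by $T_\alpha(x,i)=(x+\alpha \bmod 1,\ \phi_x(i))$, where $\phi_x=\sigma$ if $x\in[0,1-\alpha[$ and $\phi_x=\tau$ if $x\in[1-\alpha,1[$. It preserves the normalized Lebesgue measure $\mu$. A measure-preserving system $(X,T,\mu)$ is rigid if there is a sequence of integers $q_n\to\infty$ such that $\mu(T^{q_n}A\,\Delta\,A)\to0$ for every measurable set $A$. An irrational number has bounded (resp. unbounded) partial quotients if the partial quotients of its continued fraction expansion form a bounded (resp. unbounded) sequence. *)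

theory Defs
  imports
    "HOL-Probability.Probability"
    "HOL-Combinatorics.Permutations"
begin

section \<open>Square-tiled surfaces\<close>

text \<open>A point of the disjoint union of \<open>d\<close> closed unit squares is \<open>((x, y), i)\<close>: the point with
  coordinates \<open>(x, y)\<close> in the square labelled \<open>i\<close>. The first permutation \<open>\<tau>\<close> describes the gluing
  of right sides to left sides, the second one \<open>\<sigma>\<close> that of top sides to bottom sides.\<close>

type_synonym tile_point = "(real \<times> real) \<times> nat"

definition tiling_data :: "nat \<Rightarrow> (nat \<Rightarrow> nat) \<Rightarrow> (nat \<Rightarrow> nat) \<Rightarrow> bool" where
  "tiling_data d \<tau> \<sigma> \<longleftrightarrow> d \<ge> 1 \<and> \<tau> permutes {1..d} \<and> \<sigma> permutes {1..d}"

definition tiles :: "nat \<Rightarrow> tile_point set" where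
  "tiles d = ({0..1} \<times> {0..1}) \<times> {1..d}"

definition gluing :: "nat \<Rightarrow> (nat \<Rightarrow> nat) \<Rightarrow> (nat \<Rightarrow> nat) \<Rightarrow> (tile_point \<times> tile_point) set" where
  "gluing d \<tau> \<sigma> =
     {(((1, y), i), ((0, y), \<tau> i)) | y i. y \<in> {0..1} \<and> i \<in> {1..d}} \<union>
     {(((x, 1), i), ((x, 0), \<sigma> i)) | x i. x \<in> {0..1} \<and> i \<in> {1..d}}"

definition gluing_equiv :: "nat \<Rightarrow> (nat \<Rightarrow> nat) \<Rightarrow> (nat \<Rightarrow> nat) \<Rightarrow> (tile_point \<times> tile_point) set" where
  "gluing_equiv d \<tau> \<sigma> = (gluing d \<tau> \<sigma> \<union> (gluing d \<tau> \<sigma>)\<inverse>)\<^sup>* \<inter> tiles d \<times> tiles d"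

definition surface_proj :: "nat \<Rightarrow> (nat \<Rightarrow> nat) \<Rightarrow> (nat \<Rightarrow> nat) \<Rightarrow> tile_point \<Rightarrow> tile_point set" where
  "surface_proj d \<tau> \<sigma> p = gluing_equiv d \<tau> \<sigma> `` {p}"

definition square_tiled_surface ::
    "nat \<Rightarrow> (nat \<Rightarrow> nat) \<Rightarrow> (nat \<Rightarrow> nat) \<Rightarrow> tile_point set topology" where
  "square_tiled_surface d \<tau> \<sigma> = topology (\<lambda>U.
     U \<subseteq> surface_proj d \<tau> \<sigma> ` tiles d \<and>
     openin (top_of_set (tiles d)) {p \<in> tiles d. surface_proj d \<tau> \<sigma> p \<in> U})"

lemma openin_square_tiled_surface:
  "openin (square_tiled_surface d \<tau> \<sigma>) U \<longleftrightarrow>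
     U \<subseteq> surface_proj d \<tau> \<sigma> ` tiles d \<and>
     openin (top_of_set (tiles d)) {p \<in> tiles d. surface_proj d \<tau> \<sigma> p \<in> U}"
proof -
  let ?f = "surface_proj d \<tau> \<sigma>" and ?T = "top_of_set (tiles d)"
  have "istopology (\<lambda>U. U \<subseteq> ?f ` tiles d \<and> openin ?T {p \<in> tiles d. ?f p \<in> U})"
    unfolding istopology_def
  proof (intro conjI allI impI; (elim conjE)?)
    fix S T assume "openin ?T {p \<in> tiles d. ?f p \<in> S}" "openin ?T {p \<in> tiles d. ?f p \<in> T}"
    then have "openin ?T ({p \<in> tiles d. ?f p \<in> S} \<inter> {p \<in> tiles d. ?f p \<in> T})"
      by (rule openin_Int)
    also have "{p \<in> tiles d. ?f p \<in> S} \<inter> {p \<in> tiles d. ?f p \<in> T} = {p \<in> tiles d. ?f p \<in> S \<inter> T}"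
      by blast
    finally show "openin ?T {p \<in> tiles d. ?f p \<in> S \<inter> T}" .
  next
    fix \<K> assume *: "\<forall>K\<in>\<K>. K \<subseteq> ?f ` tiles d \<and> openin ?T {p \<in> tiles d. ?f p \<in> K}"
    then have "openin ?T (\<Union>K\<in>\<K>. {p \<in> tiles d. ?f p \<in> K})"
      by (intro openin_Union) blast
    also have "(\<Union>K\<in>\<K>. {p \<in> tiles d. ?f p \<in> K}) = {p \<in> tiles d. ?f p \<in> \<Union>\<K>}"
      by blast
    finally show "openin ?T {p \<in> tiles d. ?f p \<in> \<Union>\<K>}" .
  qed blast+
  then show ?thesis
    unfolding square_tiled_surface_def by (simp add: topology_inverse')
qed

lemma topspace_square_tiled_surface:
  "topspace (square_tiled_surface d \<tau> \<sigma>) = surface_proj d \<tau> \<sigma> ` tiles d"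
proof
  show "topspace (square_tiled_surface d \<tau> \<sigma>) \<subseteq> surface_proj d \<tau> \<sigma> ` tiles d"
    using openin_square_tiled_surface openin_topspace by blast
  have "{p \<in> tiles d. surface_proj d \<tau> \<sigma> p \<in> surface_proj d \<tau> \<sigma> ` tiles d} = tiles d"
    by blast
  then have "openin (square_tiled_surface d \<tau> \<sigma>) (surface_proj d \<tau> \<sigma> ` tiles d)"
    by (simp add: openin_square_tiled_surface)
  then show "surface_proj d \<tau> \<sigma> ` tiles d \<subseteq> topspace (square_tiled_surface d \<tau> \<sigma>)"
    by (rule openin_subset)
qed

lemma quotient_map_surface_proj:
  "quotient_map (top_of_set (tiles d)) (square_tiled_surface d \<tau> \<sigma>) (surface_proj d \<tau> \<sigma>)"
  unfolding quotient_map_def topspace_square_tiled_surface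
  by (auto simp: openin_square_tiled_surface)

text \<open>The cells of the decomposition of the surface into squares. Vertices are points of the
  surface, edges and faces are open cells, that is, sets of points of the surface; cells are counted
  after the gluing.\<close>

definition surface_vertices :: "nat \<Rightarrow> (nat \<Rightarrow> nat) \<Rightarrow> (nat \<Rightarrow> nat) \<Rightarrow> tile_point set set" where
  "surface_vertices d \<tau> \<sigma> = surface_proj d \<tau> \<sigma> ` (({0, 1} \<times> {0, 1}) \<times> {1..d})"

definition surface_edges :: "nat \<Rightarrow> (nat \<Rightarrow> nat) \<Rightarrow> (nat \<Rightarrow> nat) \<Rightarrow> tile_point set set set" where
  "surface_edges d \<tau> \<sigma> =
     {surface_proj d \<tau> \<sigma> ` (({a} \<times> {0<..<1}) \<times> {i}) | a i. a \<in> {0, 1} \<and> i \<in> {1..d}} \<union>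
     {surface_proj d \<tau> \<sigma> ` (({0<..<1} \<times> {b}) \<times> {i}) | b i. b \<in> {0, 1} \<and> i \<in> {1..d}}"

definition surface_faces :: "nat \<Rightarrow> (nat \<Rightarrow> nat) \<Rightarrow> (nat \<Rightarrow> nat) \<Rightarrow> tile_point set set set" where
  "surface_faces d \<tau> \<sigma> =
     {surface_proj d \<tau> \<sigma> ` (({0<..<1} \<times> {0<..<1}) \<times> {i}) | i. i \<in> {1..d}}"

definition surface_euler_char :: "nat \<Rightarrow> (nat \<Rightarrow> nat) \<Rightarrow> (nat \<Rightarrow> nat) \<Rightarrow> int" where
  "surface_euler_char d \<tau> \<sigma> =
     int (card (surface_vertices d \<tau> \<sigma>)) - int (card (surface_edges d \<tau> \<sigma>))
       + int (card (surface_faces d \<tau> \<sigma>))"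

text \<open>The genus \<open>g\<close> of a connected closed oriented surface is determined by \<open>\<chi> = 2 - 2 * g\<close>;
  in particular \<open>\<chi>\<close> is then even, so that the division below is exact.\<close>

definition surface_genus :: "nat \<Rightarrow> (nat \<Rightarrow> nat) \<Rightarrow> (nat \<Rightarrow> nat) \<Rightarrow> int" where
  "surface_genus d \<tau> \<sigma> = (2 - surface_euler_char d \<tau> \<sigma>) div 2"


section \<open>Square-tiled interval exchange transformations\<close>

definition square_tiled_iet ::
    "(nat \<Rightarrow> nat) \<Rightarrow> (nat \<Rightarrow> nat) \<Rightarrow> real \<Rightarrow> real \<times> nat \<Rightarrow> real \<times> nat" where
  "square_tiled_iet \<tau> \<sigma> \<alpha> = (\<lambda>(x, i). (frac (x + \<alpha>), if x < 1 - \<alpha> then \<sigma> i else \<tau> i))"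

definition iet_measure :: "nat \<Rightarrow> (real \<times> nat) measure" where
  "iet_measure d = restrict_space lborel {0..<1} \<Otimes>\<^sub>M uniform_count_measure {1..d}"


section \<open>Rigidity\<close>

text \<open>The images \<open>T\<^sup>q A\<close> are forward images. For invertible \<open>T\<close> with measurable inverse they are
  again measurable; see \<open>square_tiled_iet_image_measurable\<close> below.\<close>

definition rigid :: "'a measure \<Rightarrow> ('a \<Rightarrow> 'a) \<Rightarrow> bool" where
  "rigid M T \<longleftrightarrow> (\<exists>q :: nat \<Rightarrow> nat. filterlim q at_top sequentially \<and>
     (\<forall>A \<in> sets M. (\<lambda>n. measure M (sym_diff ((T ^^ q n) ` A) A)) \<longlonglongrightarrow> 0))"

lemma space_iet_measure: "space (iet_measure d) = {0..<1} \<times> {1..d}"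
  by (simp add: iet_measure_def space_pair_measure space_restrict_space space_uniform_count_measure)

lemma square_tiled_iet_image_measurable:
  assumes "tiling_data d \<tau> \<sigma>" "0 < \<alpha>" "\<alpha> < 1" "A \<in> sets (iet_measure d)"
  shows "square_tiled_iet \<tau> \<sigma> \<alpha> ` A \<in> sets (iet_measure d)"
proof -
  let ?M = "iet_measure d" and ?T = "square_tiled_iet \<tau> \<sigma> \<alpha>"
  define S where "S = (\<lambda>(y, j). if y < \<alpha> then (y - \<alpha> + 1, inv \<tau> j) else (y - \<alpha>, inv \<sigma> j))"
  have perm: "\<tau> permutes {1..d}" "\<sigma> permutes {1..d}"
    using assms by (auto simp: tiling_data_def)
  have sub: "A \<subseteq> {0..<1} \<times> {1..d}"
    using sets.sets_into_space[OF assms(4)] by (simp add: space_iet_measure)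
  have S_space: "S p \<in> {0..<1} \<times> {1..d}" if p: "p \<in> {0..<1} \<times> {1..d}" for p
  proof -
    obtain y j where yj: "p = (y, j)" "0 \<le> y" "y < 1" "j \<in> {1..d}"
      using p by (cases p) (auto simp del: atLeastAtMost_iff)
    have "inv \<tau> j \<in> {1..d}" "inv \<sigma> j \<in> {1..d}"
      using yj(4) perm by (metis permutes_inv permutes_in_image)+
    then show ?thesis using yj assms(2,3) by (simp add: S_def)
  qed
  have ST: "S (?T p) = p \<and> ?T p \<in> {0..<1} \<times> {1..d}" if p: "p \<in> {0..<1} \<times> {1..d}" for p
  proof -
    obtain x i where xi: "p = (x, i)" "0 \<le> x" "x < 1" "i \<in> {1..d}"
      using p by (cases p) (auto simp del: atLeastAtMost_iff)
    have mem: "\<tau> i \<in> {1..d}" "\<sigma> i \<in> {1..d}"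
      using xi(4) perm by (metis permutes_in_image)+
    have inv: "inv \<tau> (\<tau> i) = i" "inv \<sigma> (\<sigma> i) = i"
      using perm by (metis permutes_inverses(2))+
    show ?thesis
    proof (cases "x < 1 - \<alpha>")
      case True
      then have "frac (x + \<alpha>) = x + \<alpha>" using xi assms by (simp add: frac_eq)
      then have "?T p = (x + \<alpha>, \<sigma> i)" using True by (simp add: square_tiled_iet_def xi(1))
      moreover have "S (x + \<alpha>, \<sigma> i) = p" using xi(1,2) inv by (simp add: S_def)
      ultimately show ?thesis using True xi(2) assms(2) mem by simp
    next
      case False
      then have "frac (x + \<alpha>) = x + \<alpha> - 1"
        using xi(2,3) assms(2,3) by (intro frac_unique_iff[THEN iffD2]) (auto intro: Ints_diff)
      then have "?T p = (x + \<alpha> - 1, \<tau> i)" using False by (simp add: square_tiled_iet_def xi(1))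
      moreover have "S (x + \<alpha> - 1, \<tau> i) = p" using xi(1,3) inv by (simp add: S_def)
      ultimately show ?thesis using False xi(3) assms(3) mem by simp
    qed
  qed
  have TS: "?T (S p) = p" if p: "p \<in> {0..<1} \<times> {1..d}" for p
  proof -
    obtain y j where yj: "p = (y, j)" "0 \<le> y" "y < 1" by (cases p) (use p in auto)
    have fr: "frac y = y" "frac (y + 1) = y" using yj by (simp_all add: frac_eq frac_1_eq)
    have inv: "\<tau> (inv \<tau> j) = j" "\<sigma> (inv \<sigma> j) = j"
      using perm by (metis permutes_inverses(1))+
    show ?thesis
      by (cases "y < \<alpha>") (use yj fr inv in \<open>simp_all add: S_def square_tiled_iet_def\<close>)
  qed
  have "?T ` A = S -` A \<inter> space ?M"
    unfolding space_iet_measure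
  proof (intro equalityI subsetI)
    fix p assume "p \<in> ?T ` A"
    then show "p \<in> S -` A \<inter> {0..<1} \<times> {1..d}" using ST sub by fastforce
  next
    fix p assume "p \<in> S -` A \<inter> {0..<1} \<times> {1..d}"
    then show "p \<in> ?T ` A" using TS by (metis IntE image_eqI vimage_eq)
  qed
  moreover have "S \<in> ?M \<rightarrow>\<^sub>M ?M"
  proof -
    have [measurable]: "fst \<in> borel_measurable ?M"
      unfolding iet_measure_def
      by (rule measurable_compose[OF measurable_fst measurable_restrict_space1]) simp
    have "snd \<in> ?M \<rightarrow>\<^sub>M uniform_count_measure {1..d}"
      unfolding iet_measure_def by (rule measurable_snd)
    also have "?M \<rightarrow>\<^sub>M uniform_count_measure {1..d} = ?M \<rightarrow>\<^sub>M count_space {1..d}"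
      by (intro measurable_cong_sets refl) (simp add: sets_uniform_count_measure)
    finally have [measurable]: "snd \<in> ?M \<rightarrow>\<^sub>M count_space UNIV"
      by (rule measurable_compose) simp
    have m1: "(\<lambda>p. fst (S p)) \<in> borel_measurable ?M"
      unfolding S_def case_prod_unfold if_distrib[of fst] fst_conv by measurable
    have m2: "(\<lambda>p. snd (S p)) \<in> ?M \<rightarrow>\<^sub>M count_space UNIV"
      unfolding S_def case_prod_unfold if_distrib[of snd] snd_conv by measurable
    have S1: "(\<lambda>p. fst (S p)) \<in> ?M \<rightarrow>\<^sub>M restrict_space lborel {0..<1}"
    proof (rule measurable_restrict_space2)
      show "(\<lambda>p. fst (S p)) \<in> space ?M \<rightarrow> {0..<1}"
        unfolding space_iet_measure
        by (intro Pi_I S_space[THEN mem_Times_iff[THEN iffD1], THEN conjunct1])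
    qed (use m1 in simp)
    have "(\<lambda>p. snd (S p)) \<in> ?M \<rightarrow>\<^sub>M restrict_space (count_space UNIV) {1..d}"
    proof (rule measurable_restrict_space2)
      show "(\<lambda>p. snd (S p)) \<in> space ?M \<rightarrow> {1..d}"
        unfolding space_iet_measure
        by (intro Pi_I S_space[THEN mem_Times_iff[THEN iffD1], THEN conjunct2])
    qed (rule m2)
    also have "?M \<rightarrow>\<^sub>M restrict_space (count_space UNIV) {1..d}
        = ?M \<rightarrow>\<^sub>M uniform_count_measure {1..d}"
      by (intro measurable_cong_sets refl)
        (simp add: restrict_count_space sets_uniform_count_measure)
    finally have "(\<lambda>p. (fst (S p), snd (S p))) \<in> ?M \<rightarrow>\<^sub>M ?M"
      using S1 unfolding iet_measure_def by (intro measurable_Pair)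
    then show ?thesis by simp
  qed
  ultimately show ?thesis using assms(4) measurable_sets by metis
qed


section \<open>Continued fractions\<close>

text \<open>For irrational \<open>\<alpha>\<close> no complete quotient is an integer, so the divisor is never zero and the
  expansion \<open>[a\<^sub>0; a\<^sub>1, a\<^sub>2, \<dots>]\<close> is infinite.\<close>

primrec complete_quotient :: "real \<Rightarrow> nat \<Rightarrow> real" where
  "complete_quotient \<alpha> 0 = \<alpha>"
| "complete_quotient \<alpha> (Suc n) = 1 / frac (complete_quotient \<alpha> n)"

definition partial_quotient :: "real \<Rightarrow> nat \<Rightarrow> int" where
  "partial_quotient \<alpha> n = \<lfloor>complete_quotient \<alpha> n\<rfloor>"

definition bounded_partial_quotients :: "real \<Rightarrow> bool" where
  "bounded_partial_quotients \<alpha> \<longleftrightarrow> (\<exists>B. \<forall>n. \<bar>partial_quotient \<alpha> n\<bar> \<le> B)"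

end

theory Submission
  imports Defs "HOL-Combinatorics.Cycles"
begin

text \<open>Iterating gives \<open>T\<^sup>n (x, i) = (x + n \<alpha>, \<psi> n x i)\<close>, where \<open>\<psi> n x\<close> is a product of \<open>n\<close> factors
  \<open>\<tau>\<close>, \<open>\<sigma>\<close> coding the rotation orbit of \<open>x\<close>.

  If \<open>q \<bar>q \<alpha> - p\<bar>\<close> is small, then for most \<open>x\<close> the coding is \<open>q\<close>-periodic over any fixed number \<open>N\<close> of
  periods, so that \<open>\<psi> (N q) x = (\<psi> q x)\<^sup>N\<close>. With \<open>N\<close> a common multiple of the orders of all
  permutations this is the identity, and \<open>T\<^sup>N\<^sup>q\<close> is close to the identity.

  If \<open>\<alpha>\<close> is badly approximable, then \<open>\<psi> q\<close> is constant on \<open>q + 1\<close> arcs of length at least \<open>c / q\<close>, and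
  its values on the two sides of a discontinuity have the form \<open>A \<circ> \<tau> \<circ> \<sigma> \<circ> B\<close> and \<open>A \<circ> \<sigma> \<circ> \<tau> \<circ> B\<close>.
  As \<open>\<tau>\<close> and \<open>\<sigma>\<close> do not commute, at least one of them is not the identity, so \<open>\<psi> q\<close> differs from
  the identity on a set whose measure is bounded below independently of \<open>q\<close>.

  Finally, if \<open>\<tau>\<close> and \<open>\<sigma>\<close> commute, then each vertex of the surface determines a tile having it as
  lower left corner, so there are at least \<open>d\<close> vertices and the Euler characteristic is
  non-negative.\<close>

section \<open>Genus and commutation\<close>

lemma finite_surface_vertices: "finite (surface_vertices d \<tau> \<sigma>)"
  by (simp add: surface_vertices_def)

text \<open>Points of the surface are told apart by functions that are constant along every gluing,
  so no equivalence class has to be computed.\<close>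

lemma gluing_equiv_invariant:
  assumes "(p, q) \<in> gluing_equiv d \<tau> \<sigma>"
    and "\<And>p q. (p, q) \<in> gluing d \<tau> \<sigma> \<Longrightarrow> f p = f q"
  shows "f p = f q"
proof -
  have "(p, q) \<in> (gluing d \<tau> \<sigma> \<union> (gluing d \<tau> \<sigma>)\<inverse>)\<^sup>*"
    using assms(1) by (simp add: gluing_equiv_def)
  then show ?thesis
  proof induction
    case (step y z)
    then have "f y = f z" using assms(2)[of y z] assms(2)[of z y] by auto
    then show ?case using step.IH by simp
  qed simp
qed

lemma surface_proj_eq_invariant:
  assumes "surface_proj d \<tau> \<sigma> p = surface_proj d \<tau> \<sigma> q" "q \<in> tiles d"
    and "\<And>p q. (p, q) \<in> gluing d \<tau> \<sigma> \<Longrightarrow> f p = f q"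
  shows "f p = f q"
proof -
  have "q \<in> surface_proj d \<tau> \<sigma> q"
    using assms(2) by (simp add: surface_proj_def gluing_equiv_def)
  then have "(p, q) \<in> gluing_equiv d \<tau> \<sigma>"
    using assms(1) unfolding surface_proj_def by blast
  then show ?thesis
    using assms(3) by (rule gluing_equiv_invariant)
qed

lemma gluing_subset_tiles:
  assumes "tiling_data d \<tau> \<sigma>" "(p, q) \<in> gluing d \<tau> \<sigma>"
  shows "p \<in> tiles d" "q \<in> tiles d"
proof -
  have "\<tau> i \<in> {1..d}" "\<sigma> i \<in> {1..d}" if "i \<in> {1..d}" for i
    using assms(1) that by (metis tiling_data_def permutes_in_image)+
  then show "p \<in> tiles d" "q \<in> tiles d"
    using assms(2) by (auto simp: gluing_def tiles_def simp del: atLeastAtMost_iff) auto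
qed

lemma surface_proj_gluing:
  assumes "tiling_data d \<tau> \<sigma>" "(p, q) \<in> gluing d \<tau> \<sigma>"
  shows "surface_proj d \<tau> \<sigma> p = surface_proj d \<tau> \<sigma> q"
proof -
  let ?R = "gluing d \<tau> \<sigma> \<union> (gluing d \<tau> \<sigma>)\<inverse>"
  have "(p, q) \<in> ?R" "(q, p) \<in> ?R"
    using assms(2) by auto
  then have "(p, r) \<in> ?R\<^sup>* \<longleftrightarrow> (q, r) \<in> ?R\<^sup>*" for r
    by (meson converse_rtrancl_into_rtrancl)
  then show ?thesis
    using gluing_subset_tiles[OF assms] by (auto simp: surface_proj_def gluing_equiv_def)
qed

text \<open>Every corner moves to a lower left corner by going right with \<open>\<tau>\<close> and
  up with \<open>\<sigma>\<close>. At an upper right corner both moves are made, and commutation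
  makes the resulting label independent of their order.\<close>

lemma card_surface_vertices_commute:
  assumes "tiling_data d \<tau> \<sigma>" and comm: "\<And>i. \<tau> (\<sigma> i) = \<sigma> (\<tau> i)"
  shows "d \<le> card (surface_vertices d \<tau> \<sigma>)"
proof -
  \<comment> \<open>The label of the tile whose lower left corner is glued to the given corner.\<close>
  define f :: "tile_point \<Rightarrow> nat" where
    "f = (\<lambda>((x, y), i). (if x = 1 then \<tau> else id) ((if y = 1 then \<sigma> else id) i))"
  have f: "f p = f q" if "(p, q) \<in> gluing d \<tau> \<sigma>" for p q
    using that by (auto simp: gluing_def f_def comm)
  let ?g = "\<lambda>i. surface_proj d \<tau> \<sigma> ((0, 0), i)"
  have "inj_on ?g {1..d}"
  proof (rule inj_onI)
    fix i j assume ij: "i \<in> {1..d}" "j \<in> {1..d}" "?g i = ?g j"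
    have "((0, 0), j) \<in> tiles d" using ij(2) by (simp add: tiles_def)
    then have "f ((0, 0), i) = f ((0, 0), j)"
      by (rule surface_proj_eq_invariant[OF ij(3) _ f])
    then show "i = j" by (simp add: f_def)
  qed
  moreover have "?g ` {1..d} \<subseteq> surface_vertices d \<tau> \<sigma>"
    by (auto simp: surface_vertices_def)
  ultimately have "card {1..d} \<le> card (surface_vertices d \<tau> \<sigma>)"
    by (rule card_inj_on_le[OF _ _ finite_surface_vertices])
  then show ?thesis by simp
qed

text \<open>Each right side is a left side of the next tile and each top side a bottom side, so left
  and bottom sides give all edges. An upper bound suffices, as edges count negatively in the Euler
  characteristic.\<close>

lemma card_surface_edges_le:
  assumes "tiling_data d \<tau> \<sigma>"
  shows "card (surface_edges d \<tau> \<sigma>) \<le> 2 * d"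
proof -
  let ?P = "surface_proj d \<tau> \<sigma>"
  define v where "v = (\<lambda>i. ?P ` (({0} \<times> {0<..<1}) \<times> {i}))"
  define h where "h = (\<lambda>i. ?P ` (({0<..<1} \<times> {0}) \<times> {i}))"
  have perm: "\<tau> i \<in> {1..d}" "\<sigma> i \<in> {1..d}" if "i \<in> {1..d}" for i
    using assms that by (metis tiling_data_def permutes_in_image)+
  have vert: "({a} \<times> {0<..<1}) \<times> {i} = (\<lambda>y. ((a, y), i)) ` {0<..<1}" for a :: real and i :: nat
    by auto
  have horiz: "({0<..<1} \<times> {b}) \<times> {i} = (\<lambda>x. ((x, b), i)) ` {0<..<1}" for b :: real and i :: nat
    by auto
  have v1: "?P ` (({1} \<times> {0<..<1}) \<times> {i}) = v (\<tau> i)" if "i \<in> {1..d}" for i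
  proof -
    have "?P ((1, y), i) = ?P ((0, y), \<tau> i)" if "0 < y" "y < 1" for y
      using that \<open>i \<in> {1..d}\<close> by (intro surface_proj_gluing[OF assms]) (auto simp: gluing_def)
    then show ?thesis by (auto simp: v_def vert image_image intro!: image_cong)
  qed
  have h1: "?P ` (({0<..<1} \<times> {1}) \<times> {i}) = h (\<sigma> i)" if "i \<in> {1..d}" for i
  proof -
    have "?P ((x, 1), i) = ?P ((x, 0), \<sigma> i)" if "0 < x" "x < 1" for x
      using that \<open>i \<in> {1..d}\<close> by (intro surface_proj_gluing[OF assms]) (auto simp: gluing_def)
    then show ?thesis by (auto simp: h_def horiz image_image intro!: image_cong)
  qed
  have "surface_edges d \<tau> \<sigma> \<subseteq> v ` {1..d} \<union> h ` {1..d}"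
  proof
    fix e assume "e \<in> surface_edges d \<tau> \<sigma>"
    then consider a i where "a \<in> {0, 1}" "i \<in> {1..d}" "e = ?P ` (({a} \<times> {0<..<1}) \<times> {i})"
      | b i where "b \<in> {0, 1}" "i \<in> {1..d}" "e = ?P ` (({0<..<1} \<times> {b}) \<times> {i})"
      unfolding surface_edges_def by blast
    then show "e \<in> v ` {1..d} \<union> h ` {1..d}"
    proof cases
      case 1
      then have "e = v i \<or> e = v (\<tau> i)" using v1 by (auto simp: v_def)
      then show ?thesis using 1(2) perm by blast
    next
      case 2
      then have "e = h i \<or> e = h (\<sigma> i)" using h1 by (auto simp: h_def)
      then show ?thesis using 2(2) perm by blast
    qed
  qed
  then have "card (surface_edges d \<tau> \<sigma>) \<le> card (v ` {1..d} \<union> h ` {1..d})"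
    by (intro card_mono) auto
  also have "\<dots> \<le> card (v ` {1..d}) + card (h ` {1..d})" by (rule card_Un_le)
  also have "\<dots> \<le> d + d"
    using card_image_le[of "{1..d}" v] card_image_le[of "{1..d}" h] by simp
  finally show ?thesis by simp
qed

lemma card_surface_faces: "card (surface_faces d \<tau> \<sigma>) = d"
proof -
  let ?P = "surface_proj d \<tau> \<sigma>"
  let ?F = "\<lambda>i. ?P ` (({0<..<1} \<times> {0<..<1}) \<times> {i})"
  \<comment> \<open>Interior points of a tile are glued to no other point, so the label is an invariant there.\<close>
  define f :: "tile_point \<Rightarrow> nat" where
    "f = (\<lambda>((x, y), i). if x \<in> {0<..<1} \<and> y \<in> {0<..<1} then i else 0)"
  have f: "f p = f q" if "(p, q) \<in> gluing d \<tau> \<sigma>" for p q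
    using that by (auto simp: gluing_def f_def)
  have "inj_on ?F {1..d}"
  proof (rule inj_onI)
    fix i j assume ij: "i \<in> {1..d}" "j \<in> {1..d}" "?F i = ?F j"
    have "?P ((1/2, 1/2), i) \<in> ?F i" by (rule imageI) simp
    then obtain x y where xy: "0 < x" "x < 1" "0 < y" "y < 1"
      "?P ((1/2, 1/2), i) = ?P ((x, y), j)"
      unfolding ij(3) by auto
    have "((x, y), j) \<in> tiles d" using ij(2) xy by (simp add: tiles_def)
    then have "f ((1/2, 1/2), i) = f ((x, y), j)"
      by (rule surface_proj_eq_invariant[OF xy(5) _ f])
    then show "i = j" using xy by (simp add: f_def)
  qed
  moreover have "surface_faces d \<tau> \<sigma> = ?F ` {1..d}"
    unfolding surface_faces_def by blast
  ultimately show ?thesis by (simp add: card_image)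
qed

lemma surface_genus_commute:
  assumes "tiling_data d \<tau> \<sigma>" "\<And>i. \<tau> (\<sigma> i) = \<sigma> (\<tau> i)"
  shows "surface_genus d \<tau> \<sigma> \<le> 1"
proof -
  have "surface_euler_char d \<tau> \<sigma> \<ge> 0"
    using card_surface_vertices_commute[OF assms] card_surface_edges_le[OF assms(1)]
      card_surface_faces[of d \<tau> \<sigma>]
    unfolding surface_euler_char_def by linarith
  then show ?thesis
    unfolding surface_genus_def by linarith
qed


section \<open>Badly approximable numbers\<close>

text \<open>This is the form in which bounded partial quotients enter the dynamics.\<close>

definition badly_approximable :: "real \<Rightarrow> bool" where
  "badly_approximable \<alpha> \<longleftrightarrow>
     (\<exists>c>0. \<forall>q\<ge>1. \<forall>p::int. \<bar>real q * \<alpha> - of_int p\<bar> \<ge> c / real q)"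

section \<open>Convergents and their errors\<close>

lemma frac_pos_irrational:
  assumes "x \<notin> \<rat>" shows "0 < frac x"
  using assms Ints_subset_Rats by (auto simp: frac_gt_0_iff)

lemma complete_quotient_irrational:
  assumes "\<alpha> \<notin> \<rat>" shows "complete_quotient \<alpha> n \<notin> \<rat>"
proof (induction n)
  case (Suc n)
  let ?x = "complete_quotient \<alpha> n"
  show ?case
  proof
    assume "complete_quotient \<alpha> (Suc n) \<in> \<rat>"
    then have "inverse (complete_quotient \<alpha> (Suc n)) \<in> \<rat>" by (rule Rats_inverse)
    then have "?x \<in> \<rat>" by (simp add: inverse_eq_divide)
    then show False using Suc by contradiction
  qed
qed (use assms in simp)

text \<open>The distance \<open>\<bar>q\<^sub>n \<alpha> - p\<^sub>n\<bar>\<close> of the convergents is \<open>cf_error \<alpha> (n + 1)\<close> and the denominator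
  \<open>q\<^sub>n\<close> is \<open>cf_denom \<alpha> (n + 1)\<close>; index 0 stands for the formal convergent \<open>1 / 0\<close>.\<close>

primrec cf_error :: "real \<Rightarrow> nat \<Rightarrow> real" where
  "cf_error \<alpha> 0 = 1"
| "cf_error \<alpha> (Suc n) = cf_error \<alpha> n * frac (complete_quotient \<alpha> n)"

fun cf_denom :: "real \<Rightarrow> nat \<Rightarrow> nat" where
  "cf_denom \<alpha> 0 = 0"
| "cf_denom \<alpha> (Suc 0) = 1"
| "cf_denom \<alpha> (Suc (Suc n)) =
     nat (partial_quotient \<alpha> (Suc n)) * cf_denom \<alpha> (Suc n) + cf_denom \<alpha> n"

context
  fixes \<alpha> :: real
  assumes irrational: "\<alpha> \<notin> \<rat>"
begin

lemma frac_complete_quotient: "0 < frac (complete_quotient \<alpha> n)" "frac (complete_quotient \<alpha> n) < 1"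
  using frac_pos_irrational[OF complete_quotient_irrational[OF irrational]] frac_lt_1 by auto

lemma partial_quotient_Suc_ge_1: "partial_quotient \<alpha> (Suc n) \<ge> 1"
  using frac_complete_quotient[of n] by (simp add: partial_quotient_def le_floor_iff)

lemma cf_error_pos: "0 < cf_error \<alpha> n"
  by (induction n) (use frac_complete_quotient in auto)

text \<open>With \<open>x\<close> the fractional part of the complete quotient at \<open>n\<close>,
  this is \<open>frac (1 / x) = 1 / x - a\<close> multiplied by the error at
  \<open>Suc n\<close>.\<close>

lemma cf_error_Suc_Suc:
  "cf_error \<alpha> (Suc (Suc n)) = cf_error \<alpha> n - of_int (partial_quotient \<alpha> (Suc n)) * cf_error \<alpha> (Suc n)"
  using frac_complete_quotient(1)[of n]
  by (simp add: partial_quotient_def frac_def[of "1 / _"] field_simps)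

lemma cf_denom_Suc_Suc:
  "real (cf_denom \<alpha> (Suc (Suc n))) =
     of_int (partial_quotient \<alpha> (Suc n)) * real (cf_denom \<alpha> (Suc n)) + real (cf_denom \<alpha> n)"
  using partial_quotient_Suc_ge_1[of n] by simp

lemma cf_denom_Suc_ge_1: "cf_denom \<alpha> (Suc n) \<ge> 1"
proof (induction n)
  case (Suc n)
  have "nat (partial_quotient \<alpha> (Suc n)) * cf_denom \<alpha> (Suc n) \<ge> 1"
    using Suc partial_quotient_Suc_ge_1[of n] by (simp add: Suc_le_eq)
  then show ?case unfolding cf_denom.simps(3) by linarith
qed simp

text \<open>The two recurrences have the same coefficient with opposite signs, so the sum is
  invariant. It is the determinant identity of consecutive convergents, with the alternating signs
  absorbed in the errors.\<close>

lemma cf_denom_error: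
  "real (cf_denom \<alpha> (Suc n)) * cf_error \<alpha> n + real (cf_denom \<alpha> n) * cf_error \<alpha> (Suc n) = 1"
proof (induction n)
  case (Suc n)
  then show ?case
    unfolding cf_denom_Suc_Suc cf_error_Suc_Suc by (simp add: algebra_simps del: cf_error.simps(2))
qed simp

lemma cf_error_eq:
  "(\<exists>p::int. real (cf_denom \<alpha> n) * \<alpha> - of_int p = (-1) ^ Suc n * cf_error \<alpha> n) \<and>
   (\<exists>p::int. real (cf_denom \<alpha> (Suc n)) * \<alpha> - of_int p = (-1) ^ n * cf_error \<alpha> (Suc n))"
proof (induction n)
  case 0
  have "real (cf_denom \<alpha> 0) * \<alpha> - of_int 1 = (-1) ^ Suc 0 * cf_error \<alpha> 0" by simp
  moreover have "real (cf_denom \<alpha> (Suc 0)) * \<alpha> - of_int \<lfloor>\<alpha>\<rfloor> = (-1) ^ 0 * cf_error \<alpha> (Suc 0)"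
    by (simp add: frac_def)
  ultimately show ?case by blast
next
  case (Suc n)
  then obtain p p' :: int where p:
    "real (cf_denom \<alpha> n) * \<alpha> - of_int p = (-1) ^ Suc n * cf_error \<alpha> n"
    "real (cf_denom \<alpha> (Suc n)) * \<alpha> - of_int p' = (-1) ^ n * cf_error \<alpha> (Suc n)" by blast
  let ?a = "partial_quotient \<alpha> (Suc n)"
  have "real (cf_denom \<alpha> (Suc (Suc n))) * \<alpha> - of_int (?a * p' + p) =
    of_int ?a * (real (cf_denom \<alpha> (Suc n)) * \<alpha> - of_int p') + (real (cf_denom \<alpha> n) * \<alpha> - of_int p)"
    unfolding cf_denom_Suc_Suc by (simp add: algebra_simps)
  also have "\<dots> = (-1) ^ Suc n * cf_error \<alpha> (Suc (Suc n))"
    unfolding p cf_error_Suc_Suc by (simp add: algebra_simps del: cf_error.simps(2))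
  finally have "\<exists>p::int. real (cf_denom \<alpha> (Suc (Suc n))) * \<alpha> - of_int p =
    (-1) ^ Suc n * cf_error \<alpha> (Suc (Suc n))" by blast
  then show ?case using p(2) by (simp del: cf_error.simps(2)) metis
qed

lemma cf_convergent:
  obtains p :: int where "\<bar>real (cf_denom \<alpha> n) * \<alpha> - of_int p\<bar> = cf_error \<alpha> n"
proof -
  obtain p :: int where "real (cf_denom \<alpha> n) * \<alpha> - of_int p = (-1) ^ Suc n * cf_error \<alpha> n"
    using cf_error_eq[of n] by blast
  then have "\<bar>real (cf_denom \<alpha> n) * \<alpha> - of_int p\<bar> = cf_error \<alpha> n"
    using cf_error_pos[of n] by (simp add: abs_mult power_abs)
  then show thesis by (rule that)
qed

lemma cf_denom_error_le: "real (cf_denom \<alpha> (Suc n)) * cf_error \<alpha> n \<le> 1"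
  using cf_denom_error[of n] cf_error_pos[of "Suc n"]
  by (smt (verit) of_nat_0_le_iff mult_nonneg_nonneg)

text \<open>The error at \<open>n\<close> is at least the sum of the next two, and errors decrease,
  so two steps halve it.\<close>

lemma cf_error_le_power: "cf_error \<alpha> (2 * n) \<le> (1 / 2) ^ n"
proof (induction n)
  case (Suc n)
  let ?e = "cf_error \<alpha> (2 * n)" and ?e1 = "cf_error \<alpha> (Suc (2 * n))"
    and ?e2 = "cf_error \<alpha> (Suc (Suc (2 * n)))"
  have "?e2 \<le> ?e1"
    using frac_complete_quotient[of "Suc (2 * n)"] cf_error_pos[of "Suc (2 * n)"]
    unfolding cf_error.simps(2)[of _ "Suc (2 * n)"] by (intro mult_left_le) auto
  moreover have "1 * ?e1 \<le> of_int (partial_quotient \<alpha> (Suc (2 * n))) * ?e1"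
    using partial_quotient_Suc_ge_1[of "2 * n"] cf_error_pos[of "Suc (2 * n)"]
    by (intro mult_right_mono) auto
  ultimately have "2 * ?e2 \<le> ?e"
    using cf_error_Suc_Suc[of "2 * n"] by linarith
  then have "?e2 \<le> (1 / 2) ^ Suc n" using Suc by simp
  then show ?case by (simp del: cf_error.simps(2))
qed simp

text \<open>Compare \<open>p / q\<close> with the first convergent of error at most
  \<open>1 / (2 q)\<close>. Either the fractions agree and the bounded partial quotient keeps the
  error large, or their cross determinant is a non-zero integer, which keeps \<open>p / q\<close>
  away from \<alpha>.\<close>

lemma bounded_partial_quotients_imp_badly_approximable:
  assumes "bounded_partial_quotients \<alpha>"
  shows "badly_approximable \<alpha>"
proof -
  obtain B where B: "\<And>n. \<bar>partial_quotient \<alpha> n\<bar> \<le> B"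
    using assms by (auto simp: bounded_partial_quotients_def)
  have B1: "B \<ge> 1" using B[of 1] partial_quotient_Suc_ge_1[of 0] by simp
  \<comment> \<open>\<open>w\<close> bounds the fractional parts from below, as they are reciprocals
    of complete quotients below \<open>B + 1\<close>; the factor 1/4 in \<open>c\<close> serves both
    cases below.\<close>
  define w where "w = 1 / (of_int B + 1 :: real)"
  define c where "c = w / 4"
  have w: "0 < w" "w \<le> 1" using B1 by (simp_all add: w_def)
  have c: "c > 0" using w by (simp add: c_def)
  have "c / real q \<le> \<bar>real q * \<alpha> - of_int p\<bar>" if q: "q \<ge> 1" for q and p :: int
  proof -
    obtain k where k: "(1 / 2) ^ k < 1 / (2 * real q)"
      using real_arch_pow_inv[of "1 / (2 * real q)" "1/2"] q by auto
    have "cf_error \<alpha> (2 * k) \<le> 1 / (2 * real q)" using cf_error_le_power[of k] k by linarith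
    then have ex: "real q * cf_error \<alpha> (2 * k) \<le> 1 / 2" using q by (simp add: field_simps)
    define n where "n = (LEAST n. real q * cf_error \<alpha> n \<le> 1 / 2)"
    have n: "real q * cf_error \<alpha> n \<le> 1 / 2"
      unfolding n_def using ex by (rule LeastI)
    have "n \<noteq> 0" using n q by (intro notI) auto
    then obtain m where m: "n = Suc m" using not0_implies_Suc by blast
    have "\<not> real q * cf_error \<alpha> m \<le> 1 / 2"
      using not_less_Least[of m "\<lambda>n. real q * cf_error \<alpha> n \<le> 1 / 2"] m n_def by simp
    \<comment> \<open>By minimality of \<open>n\<close> the preceding error is still large, which
      forces the denominator at \<open>n\<close> to be at most \<open>2 q\<close>.\<close>
    then have em: "1 / (2 * real q) < cf_error \<alpha> m" using q by (simp add: field_simps)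
    let ?Q = "real (cf_denom \<alpha> n)"
    have Qpos: "?Q \<ge> 1" using cf_denom_Suc_ge_1[of m] m by simp
    have "?Q * (1 / (2 * real q)) \<le> ?Q * cf_error \<alpha> m"
      using em Qpos by (intro mult_left_mono) auto
    also have "\<dots> \<le> 1" using cf_denom_error_le[of m] m by simp
    finally have Qq: "?Q \<le> 2 * real q" using q by (simp add: field_simps)
    obtain h :: int where h: "\<bar>?Q * \<alpha> - of_int h\<bar> = cf_error \<alpha> n" by (rule cf_convergent)
    let ?D = "real q * \<alpha> - of_int p"
    show ?thesis
    proof (cases "int q * h = p * int (cf_denom \<alpha> n)")
      case True
      have "?Q * ?D = real q * (?Q * \<alpha> - of_int h) + of_int (int q * h - p * int (cf_denom \<alpha> n))"
        by (simp add: algebra_simps)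
      then have "?Q * \<bar>?D\<bar> = real q * cf_error \<alpha> n"
        using True h by (metis abs_mult abs_of_nat add_0_right diff_self of_int_0)
      moreover have "?Q * \<bar>?D\<bar> \<le> 2 * real q * \<bar>?D\<bar>"
        using Qq by (intro mult_right_mono) auto
      ultimately have D: "cf_error \<alpha> n \<le> 2 * \<bar>?D\<bar>" using q by simp
      have "complete_quotient \<alpha> n < of_int B + 1"
        using B[of n] unfolding partial_quotient_def by linarith
      then have "w < frac (complete_quotient \<alpha> m)"
        using frac_complete_quotient[of m] m B1 by (simp add: w_def field_simps)
      then have "1 / (2 * real q) * w \<le> cf_error \<alpha> n"
        unfolding m cf_error.simps using em w cf_error_pos[of m] by (intro mult_mono) auto
      then have "2 * (c / real q) \<le> cf_error \<alpha> n" by (simp add: c_def)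
      then have "2 * (c / real q) \<le> 2 * \<bar>?D\<bar>" using D by (rule order_trans)
      then show ?thesis by (simp only: mult_le_cancel_left_pos zero_less_numeral)
    next
      case False
      then have "1 \<le> \<bar>int q * h - p * int (cf_denom \<alpha> n)\<bar>" by linarith
      then have "1 \<le> \<bar>of_int (int q * h - p * int (cf_denom \<alpha> n)) :: real\<bar>"
        by (metis of_int_1_le_iff of_int_abs)
      also have "of_int (int q * h - p * int (cf_denom \<alpha> n)) =
          ?Q * ?D - real q * (?Q * \<alpha> - of_int h)"
        by (simp add: algebra_simps)
      also have "\<bar>\<dots>\<bar> \<le> \<bar>?Q * ?D\<bar> + \<bar>real q * (?Q * \<alpha> - of_int h)\<bar>"
        by (rule abs_triangle_ineq4)
      also have "\<dots> = ?Q * \<bar>?D\<bar> + real q * cf_error \<alpha> n"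
        using h by (simp add: abs_mult)
      also have "\<dots> \<le> 2 * real q * \<bar>?D\<bar> + 1 / 2"
        using Qq n by (intro add_mono mult_right_mono) auto
      finally have "1 / (4 * real q) \<le> \<bar>?D\<bar>" using q by (simp add: field_simps)
      moreover have "c / real q \<le> 1 / (4 * real q)"
        using w q by (simp add: c_def field_simps)
      ultimately show ?thesis by linarith
    qed
  qed
  then show ?thesis using c unfolding badly_approximable_def by blast
qed

text \<open>A large partial quotient \<open>a\<close> makes the convergent before it too good:
  \<open>a\<close> times its denominator is at most the next denominator, whose product with the
  error is at most 1.\<close>

lemma badly_approximable_imp_bounded_partial_quotients:
  assumes "badly_approximable \<alpha>"
  shows "bounded_partial_quotients \<alpha>"
proof -
  obtain c where c: "c > 0"
    "\<And>q p. q \<ge> 1 \<Longrightarrow> c / real q \<le> \<bar>real q * \<alpha> - of_int p\<bar>" for p :: int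
    using assms unfolding badly_approximable_def by blast
  have "\<bar>partial_quotient \<alpha> n\<bar> \<le> max \<bar>partial_quotient \<alpha> 0\<bar> \<lceil>1 / c\<rceil>" for n
  proof (cases n)
    case (Suc m)
    let ?a = "partial_quotient \<alpha> (Suc m)" and ?Q = "real (cf_denom \<alpha> (Suc m))"
    have Q: "cf_denom \<alpha> (Suc m) \<ge> 1" by (rule cf_denom_Suc_ge_1)
    obtain p :: int where "\<bar>?Q * \<alpha> - of_int p\<bar> = cf_error \<alpha> (Suc m)" by (rule cf_convergent)
    then have "c / ?Q \<le> cf_error \<alpha> (Suc m)" using c(2)[OF Q, of p] by simp
    then have "c \<le> ?Q * cf_error \<alpha> (Suc m)" using Q by (simp add: field_simps del: cf_error.simps(2))
    then have "of_int ?a * c \<le> of_int ?a * (?Q * cf_error \<alpha> (Suc m))"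
      using partial_quotient_Suc_ge_1[of m] by (intro mult_left_mono) auto
    also have "\<dots> \<le> real (cf_denom \<alpha> (Suc (Suc m))) * cf_error \<alpha> (Suc m)"
      unfolding cf_denom_Suc_Suc using cf_error_pos[of "Suc m"]
      by (simp add: algebra_simps del: cf_error.simps(2))
    also have "\<dots> \<le> 1" by (rule cf_denom_error_le)
    finally have "of_int ?a \<le> 1 / c" using c(1) by (simp add: field_simps)
    then have "?a \<le> \<lceil>1 / c\<rceil>" by linarith
    then show ?thesis using Suc partial_quotient_Suc_ge_1[of m] by simp
  qed simp
  then show ?thesis unfolding bounded_partial_quotients_def by blast
qed

lemma bounded_partial_quotients_iff_badly_approximable:
  "bounded_partial_quotients \<alpha> \<longleftrightarrow> badly_approximable \<alpha>"
  using bounded_partial_quotients_imp_badly_approximable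
    badly_approximable_imp_bounded_partial_quotients by blast

end

text \<open>The distances of q \<alpha> to the nearest integer are positive for the finitely many q
  up to \<open>K\<close>; a constant below all of them excludes these q.\<close>

lemma not_badly_approximable_arbitrarily_large:
  assumes "\<alpha> \<notin> \<rat>" "\<not> badly_approximable \<alpha>" "c > 0"
  obtains q and p :: int where "q > K" "real q * \<bar>real q * \<alpha> - of_int p\<bar> < c"
proof -
  define m where "m q = min (frac (real q * \<alpha>)) (1 - frac (real q * \<alpha>))" for q
  have m_le: "m q \<le> \<bar>real q * \<alpha> - of_int p\<bar>" for q and p :: int
  proof (cases "p \<le> \<lfloor>real q * \<alpha>\<rfloor>")
    case True
    then have "of_int p \<le> (of_int \<lfloor>real q * \<alpha>\<rfloor> :: real)" by linarith
    then show ?thesis unfolding m_def frac_def by linarith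
  next
    case False
    then have "of_int p \<ge> (of_int (\<lfloor>real q * \<alpha>\<rfloor> + 1) :: real)" by linarith
    then show ?thesis unfolding m_def frac_def by simp
  qed
  have m_pos: "m q > 0" if "q \<ge> 1" for q
  proof -
    have "real q * \<alpha> \<notin> \<rat>"
    proof
      assume "real q * \<alpha> \<in> \<rat>"
      then have "real q * \<alpha> / real q \<in> \<rat>" by (intro Rats_divide) auto
      then show False using assms(1) that by simp
    qed
    then show ?thesis using frac_pos_irrational frac_lt_1[of "real q * \<alpha>"] by (simp add: m_def)
  qed
  define c' where "c' = Min (insert c (m ` {1..K}))"
  have c': "c' > 0" "c' \<le> c" "\<And>q. q \<in> {1..K} \<Longrightarrow> c' \<le> m q"
  proof -
    show "c' > 0" unfolding c'_def using m_pos assms(3) by (subst Min_gr_iff) auto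
    show "c' \<le> c" unfolding c'_def by (rule Min_le) auto
    show "c' \<le> m q" if "q \<in> {1..K}" for q unfolding c'_def by (rule Min_le) (use that in auto)
  qed
  obtain q and p :: int where qp: "q \<ge> 1" "\<bar>real q * \<alpha> - of_int p\<bar> < c' / real q"
    using assms(2) c'(1) unfolding badly_approximable_def by (auto simp: not_le)
  then have lt: "real q * \<bar>real q * \<alpha> - of_int p\<bar> < c'" by (simp add: field_simps)
  have "q > K"
  proof (rule ccontr)
    assume "\<not> q > K"
    then have "c' \<le> 1 * \<bar>real q * \<alpha> - of_int p\<bar>" using c'(3)[of q] m_le[of q p] qp(1) by simp
    also have "\<dots> \<le> real q * \<bar>real q * \<alpha> - of_int p\<bar>"
      using qp(1) by (intro mult_right_mono) auto
    finally show False using lt by simp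
  qed
  then show thesis using lt c'(2) by (intro that[of q p]) auto
qed


section \<open>The permutation cocycle over the rotation\<close>

text \<open>An inner compact set has positive distance to the complement of an outer open set, so
  small translations keep the former inside the latter.\<close>

lemma measure_sym_diff_translation:
  fixes A :: "'a::euclidean_space set"
  assumes "A \<in> sets lebesgue" "bounded A" "e > 0"
  obtains \<delta> where "\<delta> > 0"
    "\<And>s. norm s < \<delta> \<Longrightarrow> measure lebesgue (sym_diff ((+) s ` A) A) \<le> e"
proof -
  \<comment> \<open>The final estimate has four pieces, two of them translated, hence
    \<open>e/4\<close>.\<close>
  obtain U where U: "open U" "A \<subseteq> U" "U - A \<in> lmeasurable" "emeasure lebesgue (U - A) < ennreal (e/4)"
    using sets_lebesgue_outer_open[of A "e/4"] assms by auto
  obtain K where K: "closed K" "K \<subseteq> A" "A - K \<in> lmeasurable" "emeasure lebesgue (A - K) < ennreal (e/4)"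
    using sets_lebesgue_inner_closed[of A "e/4"] assms by auto
  have "compact K"
    using K assms(2) bounded_subset compact_eq_bounded_closed by blast
  moreover have "K \<inter> (- U) = {}" using K U by blast
  ultimately obtain \<delta> where \<delta>: "\<delta> > 0" "\<And>x y. x \<in> K \<Longrightarrow> y \<in> - U \<Longrightarrow> \<delta> \<le> dist x y"
    using separate_compact_closed[of K "- U"] U(1) by (metis closed_Compl)
  have m: "measure lebesgue (U - A) \<le> e/4" "measure lebesgue (A - K) \<le> e/4"
    using U(4) K(4) assms(3) unfolding measure_def
    by (metis enn2real_leI less_imp_le divide_nonneg_pos zero_less_numeral)+
  have "measure lebesgue (sym_diff ((+) s ` A) A) \<le> e" if s: "norm s < \<delta>" for s
  proof -
    have near: "x + s \<in> U" "x - s \<in> U" if "x \<in> K" for x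
      using \<delta>(2)[OF that, of "x + s"] \<delta>(2)[OF that, of "x - s"] s by (auto simp: dist_norm)
    have sub: "sym_diff ((+) s ` A) A \<subseteq>
      ((+) s ` (A - K) \<union> (U - A)) \<union> ((A - K) \<union> (+) s ` (U - A))" (is "_ \<subseteq> ?W")
    proof
      fix y assume "y \<in> sym_diff ((+) s ` A) A"
      then consider x where "x \<in> A" "y = s + x" "y \<notin> A" | "y \<in> A" "y \<notin> (+) s ` A" by blast
      then show "y \<in> ?W"
      proof cases
        case 1
        then show ?thesis using near(1)[of x] by (auto simp: add.commute)
      next
        case 2
        have "y - s \<notin> A" using 2(2) by (metis add.commute diff_add_cancel imageI)
        moreover have "y = s + (y - s)" by simp
        ultimately show ?thesis using near(2)[of y] 2(1) by blast
      qed
    qed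
    have tr: "(+) s ` (A - K) \<in> lmeasurable" "(+) s ` (U - A) \<in> lmeasurable"
      using K U by (auto intro: measurable_translation)
    have "sym_diff ((+) s ` A) A \<in> sets lebesgue"
      using assms(1) lebesgue_sets_translation by blast
    then have "measure lebesgue (sym_diff ((+) s ` A) A) \<le> measure lebesgue ?W"
      using sub tr K(3) U(3) by (intro measure_mono_fmeasurable fmeasurable.Un)
    also have "\<dots> \<le> (measure lebesgue ((+) s ` (A - K)) + measure lebesgue (U - A)) +
        (measure lebesgue (A - K) + measure lebesgue ((+) s ` (U - A)))"
      using tr K(3) U(3)
      by (intro order_trans[OF measure_Un_le] add_mono measure_Un_le sets.Un fmeasurableD)
    also have "\<dots> \<le> e" using m by (simp add: measure_translation)
    finally show ?thesis .
  qed
  then show thesis using \<delta>(1) that by blast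
qed

text \<open>Fubini with a uniform finite second factor. Sections are measured by
  \<open>lebesgue\<close> to match the estimates for translates.\<close>

lemma
  assumes "d \<ge> 1" "B \<in> sets (iet_measure d)"
  shows iet_measure_section_sets: "(\<lambda>x. (x, i)) -` B \<in> sets borel"
    and iet_measure_section_subset: "(\<lambda>x. (x, i)) -` B \<subseteq> {0..<1}"
    and measure_iet_measure: "measure (iet_measure d) B =
      (\<Sum>i\<in>{1..d}. measure lebesgue ((\<lambda>x. (x, i)) -` B)) / real d"
proof -
  let ?M1 = "restrict_space lborel {0..<1::real}" and ?M2 = "uniform_count_measure {1..d}"
  have B: "B \<in> sets (?M1 \<Otimes>\<^sub>M ?M2)" using assms(2) by (simp add: iet_measure_def)
  have sub: "(\<lambda>x. (x, i)) -` B \<subseteq> {0..<1}" for i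
    using sets.sets_into_space[OF assms(2)] unfolding space_iet_measure by auto
  show "(\<lambda>x. (x, i)) -` B \<subseteq> {0..<1}" by (rule sub)
  have sec1: "(\<lambda>x. (x, i)) -` B \<in> sets ?M1" for i
    using B by (rule sets_Pair2)
  then have sec: "(\<lambda>x. (x, i)) -` B \<in> sets borel" for i
    by (subst (asm) sets_restrict_space_iff) auto
  show "(\<lambda>x. (x, i)) -` B \<in> sets borel" by (rule sec)
  have fin: "emeasure lborel ((\<lambda>x. (x, i)) -` B) = ennreal (measure lebesgue ((\<lambda>x. (x, i)) -` B))" for i
  proof -
    have "emeasure lborel ((\<lambda>x. (x, i)) -` B) \<le> emeasure lborel {0..<1::real}"
      using sub by (intro emeasure_mono) auto
    then have "emeasure lborel ((\<lambda>x. (x, i)) -` B) \<noteq> \<infinity>" by (auto simp: top_unique)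
    then show ?thesis using sec by (simp add: emeasure_eq_ennreal_measure)
  qed
  interpret M1: finite_measure ?M1
    by (rule finite_measureI) (simp add: space_restrict_space emeasure_restrict_space)
  interpret M2: prob_space ?M2
    using assms(1) by (intro prob_space_uniform_count_measure) auto
  interpret pair_sigma_finite ?M1 ?M2 ..
  have "emeasure (iet_measure d) B = (\<integral>\<^sup>+i. emeasure ?M1 ((\<lambda>x. (x, i)) -` B) \<partial>?M2)"
    unfolding iet_measure_def using B by (rule emeasure_pair_measure_alt2)
  also have "\<dots> = (\<integral>\<^sup>+i. ennreal (measure lebesgue ((\<lambda>x. (x, i)) -` B)) \<partial>?M2)"
    using sub by (simp add: emeasure_restrict_space fin)
  also have "\<dots> = (\<Sum>i\<in>{1..d}. ennreal (1 / d) * ennreal (measure lebesgue ((\<lambda>x. (x, i)) -` B)))"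
    unfolding uniform_count_measure_def by (subst nn_integral_point_measure_finite) auto
  also have "\<dots> = ennreal (\<Sum>i\<in>{1..d}. 1 / d * measure lebesgue ((\<lambda>x. (x, i)) -` B))"
    unfolding ennreal_mult''[symmetric, OF measure_nonneg] by (rule sum_ennreal) simp
  finally have "measure (iet_measure d) B = (\<Sum>i\<in>{1..d}. 1 / d * measure lebesgue ((\<lambda>x. (x, i)) -` B))"
    unfolding measure_def[of "iet_measure d"] by (simp add: sum_nonneg)
  then show "measure (iet_measure d) B =
      (\<Sum>i\<in>{1..d}. measure lebesgue ((\<lambda>x. (x, i)) -` B)) / real d"
    by (simp add: sum_divide_distrib)
qed

lemma floor_add_eq:
  fixes y s :: real
  assumes "\<And>p::int. \<bar>s\<bar> < \<bar>y - of_int p\<bar>"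
  shows "\<lfloor>y + s\<rfloor> = \<lfloor>y\<rfloor>"
proof (rule floor_unique)
  have "\<bar>s\<bar> < y - of_int \<lfloor>y\<rfloor>" using assms[of "\<lfloor>y\<rfloor>"] of_int_floor_le[of y] by linarith
  then show "of_int \<lfloor>y\<rfloor> \<le> y + s" by linarith
  have "\<bar>s\<bar> < of_int \<lfloor>y\<rfloor> + 1 - y"
    using assms[of "\<lfloor>y\<rfloor> + 1"] floor_correct[of y] unfolding of_int_add of_int_1 by linarith
  then show "y + s < of_int \<lfloor>y\<rfloor> + 1" by linarith
qed

text \<open>The product of exponents, one for each of the finitely many permutations, works for
  all.\<close>

lemma exists_common_permutation_order:
  assumes "finite S"
  obtains N where "N > 0" "\<And>f. f permutes S \<Longrightarrow> f ^^ N = id"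
proof -
  have "\<exists>n. f ^^ n = id \<and> n > 0" if "f permutes S" for f
    using permutation_is_nilpotent[of f] that assms permutation_permutes by metis
  then obtain k where k: "\<And>f. f permutes S \<Longrightarrow> f ^^ k f = id \<and> k f > 0" by metis
  let ?P = "{f. f permutes S}"
  have fin: "finite ?P" using assms by (rule finite_permutations)
  show thesis
  proof (rule that)
    show "prod k ?P > 0" using k by (auto intro: prod_pos)
    fix f assume f: "f permutes S"
    then obtain m where "prod k ?P = k f * m" using dvd_prodI[OF fin, of f k] by (auto elim: dvdE)
    then show "f ^^ prod k ?P = id" using k[OF f] by (simp add: funpow_mult[symmetric] flip: id_def)
  qed
qed

text \<open>The extension of \<open>\<phi>\<close> to a 1-periodic function on the real line.\<close>

definition tile_step :: "(nat \<Rightarrow> nat) \<Rightarrow> (nat \<Rightarrow> nat) \<Rightarrow> real \<Rightarrow> real \<Rightarrow> nat \<Rightarrow> nat" where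
  "tile_step \<tau> \<sigma> \<alpha> x = (if frac x < 1 - \<alpha> then \<sigma> else \<tau>)"

primrec tile_cocycle :: "(nat \<Rightarrow> nat) \<Rightarrow> (nat \<Rightarrow> nat) \<Rightarrow> real \<Rightarrow> nat \<Rightarrow> real \<Rightarrow> nat \<Rightarrow> nat" where
  "tile_cocycle \<tau> \<sigma> \<alpha> 0 x = id"
| "tile_cocycle \<tau> \<sigma> \<alpha> (Suc n) x = tile_step \<tau> \<sigma> \<alpha> (x + real n * \<alpha>) \<circ> tile_cocycle \<tau> \<sigma> \<alpha> n x"

section \<open>Cocycle identities and the skew product form of the iterates\<close>

lemma tile_cocycle_cong:
  assumes "\<And>k. k < n \<Longrightarrow> tile_step \<tau> \<sigma> \<alpha> (x + real k * \<alpha>) = tile_step \<tau> \<sigma> \<alpha> (y + real k * \<alpha>)"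
  shows "tile_cocycle \<tau> \<sigma> \<alpha> n x = tile_cocycle \<tau> \<sigma> \<alpha> n y"
  using assms by (induction n) auto

lemma tile_cocycle_add:
  "tile_cocycle \<tau> \<sigma> \<alpha> (m + n) x =
     tile_cocycle \<tau> \<sigma> \<alpha> m (x + real n * \<alpha>) \<circ> tile_cocycle \<tau> \<sigma> \<alpha> n x"
  by (induction m) (auto simp: algebra_simps comp_assoc)

lemma tile_step_add_int: "tile_step \<tau> \<sigma> \<alpha> (x + of_int p) = tile_step \<tau> \<sigma> \<alpha> x"
  by (simp add: tile_step_def)

lemma tile_cocycle_add_int: "tile_cocycle \<tau> \<sigma> \<alpha> n (x + of_int p) = tile_cocycle \<tau> \<sigma> \<alpha> n x"
proof (rule tile_cocycle_cong)
  fix k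
  show "tile_step \<tau> \<sigma> \<alpha> (x + of_int p + real k * \<alpha>) = tile_step \<tau> \<sigma> \<alpha> (x + real k * \<alpha>)"
    using tile_step_add_int[of \<tau> \<sigma> \<alpha> "x + real k * \<alpha>" p] by (simp add: algebra_simps)
qed

lemma tile_cocycle_frac:
  "tile_cocycle \<tau> \<sigma> \<alpha> n (frac x + y) = tile_cocycle \<tau> \<sigma> \<alpha> n (x + y)"
  using tile_cocycle_add_int[of \<tau> \<sigma> \<alpha> n "frac x + y" "\<lfloor>x\<rfloor>"] by (simp add: frac_def)

lemma funpow_square_tiled_iet:
  assumes "0 \<le> x" "x < 1"
  shows "(square_tiled_iet \<tau> \<sigma> \<alpha> ^^ n) (x, i) = (frac (x + real n * \<alpha>), tile_cocycle \<tau> \<sigma> \<alpha> n x i)"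
proof (induction n)
  case 0
  then show ?case using assms by (simp add: frac_eq)
next
  case (Suc n)
  then show ?case by (simp add: square_tiled_iet_def tile_step_def algebra_simps)
qed

text \<open>The base point of a preimage is y - n \<alpha> modulo 1. The cocycle is 1-periodic, so
  only membership in \<open>A\<close> needs \<open>frac\<close>.\<close>

lemma mem_funpow_square_tiled_iet_image:
  assumes "A \<subseteq> {0..<1} \<times> S"
  shows "(y, i) \<in> (square_tiled_iet \<tau> \<sigma> \<alpha> ^^ n) ` A \<longleftrightarrow> y \<in> {0..<1} \<and>
    (\<exists>k. (frac (y - real n * \<alpha>), k) \<in> A \<and> tile_cocycle \<tau> \<sigma> \<alpha> n (y - real n * \<alpha>) k = i)"
    (is "?L \<longleftrightarrow> ?R")
proof
  assume ?L
  then obtain x k where xk: "(x, k) \<in> A" "(y, i) = (square_tiled_iet \<tau> \<sigma> \<alpha> ^^ n) (x, k)" by auto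
  then have x: "0 \<le> x" "x < 1" using assms by auto
  then have y: "y = frac (x + real n * \<alpha>)" and i: "i = tile_cocycle \<tau> \<sigma> \<alpha> n x k"
    using xk(2) by (simp_all add: funpow_square_tiled_iet)
  have "y - real n * \<alpha> = x + of_int (- \<lfloor>x + real n * \<alpha>\<rfloor>)" unfolding y frac_def by simp
  then have "frac (y - real n * \<alpha>) = x" "tile_cocycle \<tau> \<sigma> \<alpha> n (y - real n * \<alpha>) k = i"
    using x i tile_cocycle_add_int by (metis frac_add_of_int_right frac_eq)+
  then show ?R using xk(1) y frac_lt_1 by auto
next
  assume ?R
  then obtain k where y: "y \<in> {0..<1}" and k: "(frac (y - real n * \<alpha>), k) \<in> A"
    "tile_cocycle \<tau> \<sigma> \<alpha> n (y - real n * \<alpha>) k = i" by blast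
  have "(square_tiled_iet \<tau> \<sigma> \<alpha> ^^ n) (frac (y - real n * \<alpha>), k) = (y, i)"
    using y k(2) tile_cocycle_frac[of \<tau> \<sigma> \<alpha> n "y - real n * \<alpha>" 0]
    by (simp add: funpow_square_tiled_iet frac_lt_1 frac_eq)
  then show ?L using k(1) by (metis imageI)
qed

lemma lmeasurable_interval_real [simp]:
  "{a<..<b} \<in> lmeasurable" "{a..b} \<in> lmeasurable" for a b :: real
  using lmeasurable_box[of a b] lmeasurable_cbox[of a b] by (simp_all add: box_real)

lemma measure_lebesgue_interval_real:
  "a \<le> b \<Longrightarrow> measure lebesgue {a<..<b} = b - a" "a \<le> b \<Longrightarrow> measure lebesgue {a..b} = b - a"
  for a b :: real
  by simp_all

locale tiled_rotation =
  fixes d :: nat and \<tau> \<sigma> :: "nat \<Rightarrow> nat" and \<alpha> :: real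
  assumes tiling_data: "tiling_data d \<tau> \<sigma>" and \<alpha>: "0 < \<alpha>" "\<alpha> < 1"
begin

abbreviation "T \<equiv> square_tiled_iet \<tau> \<sigma> \<alpha>"
abbreviation "M \<equiv> iet_measure d"
abbreviation "step \<equiv> tile_step \<tau> \<sigma> \<alpha>"
abbreviation "\<psi> \<equiv> tile_cocycle \<tau> \<sigma> \<alpha>"

lemma d_ge_1: "d \<ge> 1" and permutes_\<tau>: "\<tau> permutes {1..d}" and permutes_\<sigma>: "\<sigma> permutes {1..d}"
  using tiling_data by (auto simp: tiling_data_def)

lemma permutes_cocycle: "\<psi> n x permutes {1..d}"
proof (induction n)
  case (Suc n)
  have "tile_step \<tau> \<sigma> \<alpha> (x + real n * \<alpha>) permutes {1..d}"
    using permutes_\<tau> permutes_\<sigma> by (simp add: tile_step_def)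
  then show ?case unfolding tile_cocycle.simps by (rule permutes_compose[OF Suc])
qed (simp add: permutes_id[unfolded id_def] id_def)

text \<open>In this form \<open>step\<close> is seen to be constant on any interval that contains neither an integer
  nor a point of \<open>-\<alpha> + \<int>\<close>.\<close>

lemma step_eq: "step x = (if \<lfloor>x + \<alpha>\<rfloor> = \<lfloor>x\<rfloor> then \<sigma> else \<tau>)"
proof -
  have "frac x < 1 - \<alpha> \<longleftrightarrow> \<lfloor>x + \<alpha>\<rfloor> = \<lfloor>x\<rfloor>"
    using \<alpha> unfolding frac_def by linarith
  then show ?thesis by (simp add: tile_step_def)
qed

lemma step_perturb:
  assumes "\<And>p::int. \<bar>s\<bar> < \<bar>x - of_int p\<bar>" "\<And>p::int. \<bar>s\<bar> < \<bar>x + \<alpha> - of_int p\<bar>"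
  shows "step (x + s) = step x"
proof -
  have "\<lfloor>x + s\<rfloor> = \<lfloor>x\<rfloor>" "\<lfloor>(x + \<alpha>) + s\<rfloor> = \<lfloor>x + \<alpha>\<rfloor>"
    using assms by (intro floor_add_eq; blast)+
  moreover have "x + s + \<alpha> = (x + \<alpha>) + s" by simp
  ultimately show ?thesis by (simp only: step_eq)
qed

lemma T_image_sets:
  assumes "A \<in> sets M"
  shows "(T ^^ n) ` A \<in> sets M"
proof (induction n)
  case (Suc n)
  have "(T ^^ Suc n) ` A = T ` ((T ^^ n) ` A)" by (simp add: image_comp)
  then show ?case using square_tiled_iet_image_measurable[OF tiling_data \<alpha> Suc] by simp
qed (use assms in simp)

lemma sym_diff_sets: "A \<in> sets M \<Longrightarrow> sym_diff ((T ^^ n) ` A) A \<in> sets M"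
  using T_image_sets by blast

lemma section_bounded: "A \<in> sets M \<Longrightarrow> bounded ((\<lambda>x. (x, i)) -` A)"
  using iet_measure_section_subset[OF d_ge_1] bounded_subset[of "{0..1::real}"]
  by (meson atLeastLessThan_subseteq_atLeastAtMost_iff bounded_closed_interval order_refl subset_trans)

lemma section_lmeasurable:
  assumes "A \<in> sets M" shows "(\<lambda>x. (x, i)) -` A \<in> lmeasurable"
  using section_bounded[OF assms] iet_measure_section_sets[OF d_ge_1 assms]
  by (intro bounded_set_imp_lmeasurable) auto

lemma tile_sets: "i \<in> {1..d} \<Longrightarrow> {0..<1} \<times> {i} \<in> sets M"
  unfolding iet_measure_def
  by (intro pair_measureI) (auto simp: sets_restrict_space_iff sets_uniform_count_measure)

lemma sets_M_subset: "A \<in> sets M \<Longrightarrow> A \<subseteq> {0..<1} \<times> {1..d}"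
  using sets.sets_into_space[of A M] by (simp add: space_iet_measure)


section \<open>Bounded partial quotients\<close>

context
  fixes c :: real and q :: nat
  assumes c_pos: "0 < c" and q_ge_2: "2 \<le> q"
    and approx: "\<And>k (p::int). 1 \<le> k \<Longrightarrow> c / real k \<le> \<bar>real k * \<alpha> - of_int p\<bar>"
begin

text \<open>Signed multiples arise as differences of orbit times. Negation preserves the distance to
  the integers.\<close>

lemma approx_int:
  assumes "m \<noteq> 0" "\<bar>m\<bar> \<le> int q"
  shows "c / real q \<le> \<bar>of_int m * \<alpha> - of_int p\<bar>"
proof -
  let ?k = "nat \<bar>m\<bar>"
  have k: "1 \<le> ?k" "?k \<le> q" using assms by auto
  have "c / real q \<le> c / real ?k" using k c_pos by (intro divide_left_mono) auto
  also have "\<dots> \<le> \<bar>real ?k * \<alpha> - of_int (sgn m * p)\<bar>" using k by (intro approx)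
  also have "real ?k = of_int (sgn m) * of_int m"
    using assms by (metis abs_sgn mult.commute of_int_mult of_nat_nat abs_ge_zero of_int_of_nat_eq)
  also have "\<bar>of_int (sgn m) * of_int m * \<alpha> - of_int (sgn m * p)\<bar> =
      \<bar>of_int (sgn m) * (of_int m * \<alpha> - of_int p)\<bar>"
    by (simp add: algebra_simps)
  also have "\<dots> = \<bar>of_int m * \<alpha> - of_int p\<bar>" using assms by (auto simp: abs_mult sgn_if)
  finally show ?thesis .
qed

text \<open>The excluded values 0 and -1 put the base point on a jump of \<open>step\<close>
  itself.\<close>

lemma step_near_multiple:
  assumes "m \<noteq> 0" "m \<noteq> -1" "\<bar>m\<bar> < int q" "\<bar>s\<bar> < c / real q"
  shows "step (of_int m * \<alpha> + s) = step (of_int m * \<alpha>)"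
proof (rule step_perturb)
  fix p :: int
  show "\<bar>s\<bar> < \<bar>of_int m * \<alpha> - of_int p\<bar>" using approx_int[of m p] assms by linarith
  have "c / real q \<le> \<bar>of_int (m + 1) * \<alpha> - of_int p\<bar>" using assms by (intro approx_int) auto
  then show "\<bar>s\<bar> < \<bar>of_int m * \<alpha> + \<alpha> - of_int p\<bar>" using assms(4) by (simp add: algebra_simps)
qed

text \<open>Crossing the discontinuity \<open>-j \<alpha>\<close> of \<open>\<psi> q\<close> replaces a factor \<open>\<tau> \<circ> \<sigma>\<close> by \<open>\<sigma> \<circ> \<tau>\<close> and leaves
  all other factors unchanged.\<close>

lemma cocycle_not_id_near_discontinuity:
  assumes noncomm: "\<tau> \<circ> \<sigma> \<noteq> \<sigma> \<circ> \<tau>"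
    and j: "1 \<le> j" "j < q" and s: "0 < s" "s < c / real q" and s': "0 < s'" "s' < c / real q"
  shows "\<psi> q (- (real j * \<alpha>) - s) \<noteq> id \<or> \<psi> q (- (real j * \<alpha>) + s') \<noteq> id"
proof -
  define x where "x u = - (real j * \<alpha>) + u" for u
  \<comment> \<open>The orbit of \<open>x u\<close> is at u - \<alpha> at time \<open>j - 1\<close>
    and at \<open>u\<close> at time \<open>j\<close>. \<open>B\<close> collects the factors before
    these two times, \<open>A\<close> those after.\<close>
  define A where "A = \<psi> (q - 1 - j) (x 0 + real (j + 1) * \<alpha>)"
  define B where "B = \<psi> (j - 1) (x 0)"
  have c_le: "c / real q \<le> \<alpha>" "c / real q \<le> 1 - \<alpha>"
    using approx_int[of 1 0] approx_int[of 1 1] q_ge_2 \<alpha> by auto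
  have A: "\<psi> (q - 1 - j) (x u + real (j + 1) * \<alpha>) = A" if "\<bar>u\<bar> < c / real q" for u
    unfolding A_def
  proof (rule tile_cocycle_cong)
    fix k assume k: "k < q - 1 - j"
    have "step (of_int (int k + 1) * \<alpha> + u) = step (of_int (int k + 1) * \<alpha>)"
      using k that by (intro step_near_multiple) auto
    then show "step (x u + real (j + 1) * \<alpha> + real k * \<alpha>) = step (x 0 + real (j + 1) * \<alpha> + real k * \<alpha>)"
      by (simp add: x_def algebra_simps)
  qed
  have B: "\<psi> (j - 1) (x u) = B" if "\<bar>u\<bar> < c / real q" for u
    unfolding B_def
  proof (rule tile_cocycle_cong)
    fix k assume k: "k < j - 1"
    have "step (of_int (int k - int j) * \<alpha> + u) = step (of_int (int k - int j) * \<alpha>)"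
      using k j that by (intro step_near_multiple) auto
    then show "step (x u + real k * \<alpha>) = step (x 0 + real k * \<alpha>)"
      by (simp add: x_def algebra_simps)
  qed
  have split: "\<psi> q (x u) = A \<circ> step u \<circ> step (u - \<alpha>) \<circ> B" if "\<bar>u\<bar> < c / real q" for u
  proof -
    have q: "q = (q - 1 - j) + (j + 1)" "j + 1 = Suc (Suc (j - 1))" using j by auto
    have "\<psi> q (x u) = A \<circ> \<psi> (j + 1) (x u)"
      by (subst q(1)) (simp only: tile_cocycle_add A[OF that])
    also have "\<psi> (j + 1) (x u) = step (x u + real (Suc (j - 1)) * \<alpha>) \<circ> (step (x u + real (j - 1) * \<alpha>) \<circ> B)"
      unfolding q(2) tile_cocycle.simps B[OF that] ..
    also have "x u + real (Suc (j - 1)) * \<alpha> = u"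
      using j by (simp add: x_def)
    also have "x u + real (j - 1) * \<alpha> = u - \<alpha>"
      using j by (simp add: x_def of_nat_diff algebra_simps)
    finally show ?thesis by (simp only: comp_assoc)
  qed
  \<comment> \<open>Just left of the discontinuity the two middle steps are \<open>\<sigma>\<close>
    then \<open>\<tau>\<close>, just right of it \<open>\<tau>\<close> then
    \<open>\<sigma>\<close>.\<close>
  have floors: "\<lfloor>- s\<rfloor> = -1" "\<lfloor>\<alpha> - s\<rfloor> = 0" "\<lfloor>- s - \<alpha>\<rfloor> = -1"
    "\<lfloor>s'\<rfloor> = 0" "\<lfloor>s' + \<alpha>\<rfloor> = 0" "\<lfloor>s' - \<alpha>\<rfloor> = -1"
    using s s' c_le \<alpha> by linarith+
  have "step (- s) = \<tau>" "step (- s - \<alpha>) = \<sigma>" "step s' = \<sigma>" "step (s' - \<alpha>) = \<tau>"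
    using floors by (simp_all add: step_eq)
  then have eqs: "\<psi> q (x (- s)) = A \<circ> \<tau> \<circ> \<sigma> \<circ> B" "\<psi> q (x s') = A \<circ> \<sigma> \<circ> \<tau> \<circ> B"
    using split[of "- s"] split[of s'] s s' by simp_all
  have "A \<circ> \<tau> \<circ> \<sigma> \<circ> B \<noteq> A \<circ> \<sigma> \<circ> \<tau> \<circ> B"
  proof
    assume eq: "A \<circ> \<tau> \<circ> \<sigma> \<circ> B = A \<circ> \<sigma> \<circ> \<tau> \<circ> B"
    have "inj A" "surj B"
      using permutes_cocycle permutes_inj permutes_surj unfolding A_def B_def by blast+
    have "\<tau> (\<sigma> i) = \<sigma> (\<tau> i)" for i
    proof -
      obtain k where "i = B k" using \<open>surj B\<close> by auto
      then have "A (\<tau> (\<sigma> i)) = A (\<sigma> (\<tau> i))" using fun_cong[OF eq, of k] by simp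
      then show ?thesis using \<open>inj A\<close> by (simp add: inj_eq)
    qed
    then show False using noncomm by auto
  qed
  then show ?thesis using eqs unfolding x_def by (metis uminus_add_conv_diff add.commute)
qed

text \<open>Each of the \<open>q - 1\<close> discontinuities has a one-sided interval of length
  \<open>c / (2 q)\<close> on which the cocycle is not the identity, and these intervals are
  disjoint.\<close>

lemma measure_cocycle_not_id:
  assumes noncomm: "\<tau> \<circ> \<sigma> \<noteq> \<sigma> \<circ> \<tau>"
  obtains E where "E \<in> lmeasurable" "c / 4 \<le> measure lebesgue E" "E \<subseteq> {0..<1}"
    "\<And>y. y \<in> E \<Longrightarrow> \<psi> q (y - real q * \<alpha>) \<noteq> id"
proof -
  \<comment> \<open>Half of the guaranteed gap between discontinuities.\<close>
  define r where "r = c / (2 * real q)"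
  have r: "0 < r" "2 * r = c / real q" "r < c / real q"
    using c_pos q_ge_2 by (auto simp: r_def field_simps)
  define z where "z m = frac (real m * \<alpha>)" for m
  have z_eq: "z m = of_int (int m) * \<alpha> - of_int \<lfloor>real m * \<alpha>\<rfloor>" for m
    by (simp add: z_def frac_def)
  have "\<exists>J. (J = {z m - r<..<z m} \<or> J = {z m<..<z m + r}) \<and>
      (\<forall>y\<in>J. \<psi> q (y - real q * \<alpha>) \<noteq> id)" if m: "m \<in> {1..<q}" for m
  proof -
    \<comment> \<open>Seen from the image point \<open>y\<close>, the discontinuity -j \<alpha> with
      \<open>j = q - m\<close> sits at \<open>z m\<close>.\<close>
    have cocycle: "\<psi> q (y - real q * \<alpha>) = \<psi> q (- (real (q - m) * \<alpha>) + (y - z m))" for y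
      using tile_cocycle_add_int[of \<tau> \<sigma> \<alpha> q "y - real q * \<alpha>" "\<lfloor>real m * \<alpha>\<rfloor>"] m
      by (simp add: z_eq of_nat_diff algebra_simps)
    have "(\<forall>y\<in>{z m - r<..<z m}. \<psi> q (y - real q * \<alpha>) \<noteq> id) \<or>
        (\<forall>y\<in>{z m<..<z m + r}. \<psi> q (y - real q * \<alpha>) \<noteq> id)"
    proof (rule ccontr)
      assume "\<not> ?thesis"
      then obtain y y' where y: "z m - r < y" "y < z m" "\<psi> q (y - real q * \<alpha>) = id"
        and y': "z m < y'" "y' < z m + r" "\<psi> q (y' - real q * \<alpha>) = id" by auto
      have "\<psi> q (- (real (q - m) * \<alpha>) - (z m - y)) \<noteq> id \<or>
          \<psi> q (- (real (q - m) * \<alpha>) + (y' - z m)) \<noteq> id"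
        using y y' r m by (intro cocycle_not_id_near_discontinuity noncomm) auto
      moreover have "- (real (q - m) * \<alpha>) - (z m - y) = - (real (q - m) * \<alpha>) + (y - z m)" by simp
      ultimately show False using y(3) y'(3) cocycle by metis
    qed
    then show ?thesis by blast
  qed
  then obtain J where J: "\<And>m. m \<in> {1..<q} \<Longrightarrow> J m = {z m - r<..<z m} \<or> J m = {z m<..<z m + r}"
    "\<And>m y. m \<in> {1..<q} \<Longrightarrow> y \<in> J m \<Longrightarrow> \<psi> q (y - real q * \<alpha>) \<noteq> id"
    by metis
  have J_near: "\<bar>y - z m\<bar> < r" if "m \<in> {1..<q}" "y \<in> J m" for m y
    using J(1)[OF that(1)] that(2) by auto
  have meas: "J m \<in> lmeasurable" "measure lebesgue (J m) = r" if "m \<in> {1..<q}" for m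
    using J(1)[OF that] r(1) by (auto simp: measure_lebesgue_interval_real)
  have disj: "pairwise (\<lambda>m m'. disjnt (J m) (J m')) {1..<q}"
  proof (rule pairwiseI)
    fix m m' assume mm: "m \<in> {1..<q}" "m' \<in> {1..<q}" "m \<noteq> m'"
    have "c / real q \<le> \<bar>of_int (int m - int m') * \<alpha> - of_int (\<lfloor>real m * \<alpha>\<rfloor> - \<lfloor>real m' * \<alpha>\<rfloor>)\<bar>"
      using mm by (intro approx_int) auto
    then have "2 * r \<le> \<bar>z m - z m'\<bar>" unfolding r(2) z_eq by (simp add: algebra_simps)
    then show "disjnt (J m) (J m')"
      using J_near[OF mm(1)] J_near[OF mm(2)] unfolding disjnt_def by fastforce
  qed
  show thesis
  proof (rule that)
    show "(\<Union>m\<in>{1..<q}. J m) \<in> lmeasurable" using meas by (intro fmeasurable.finite_UN) auto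
    have "measure lebesgue (\<Union>m\<in>{1..<q}. J m) = (\<Sum>m\<in>{1..<q}. measure lebesgue (J m))"
      using meas disj by (intro measure_UNION') auto
    also have "\<dots> = real (q - 1) * r" using meas by simp
    finally have "measure lebesgue (\<Union>m\<in>{1..<q}. J m) = real (q - 1) * r" .
    moreover have "c / 4 \<le> real (q - 1) * r"
    proof -
      have "real q / 2 * r \<le> real (q - 1) * r" using q_ge_2 r(1) by (intro mult_right_mono) auto
      then show ?thesis using q_ge_2 by (simp add: r_def)
    qed
    ultimately show "c / 4 \<le> measure lebesgue (\<Union>m\<in>{1..<q}. J m)" by simp
    show "(\<Union>m\<in>{1..<q}. J m) \<subseteq> {0..<1}"
    proof
      fix y assume "y \<in> (\<Union>m\<in>{1..<q}. J m)"
      then obtain m where m: "m \<in> {1..<q}" "\<bar>y - z m\<bar> < r" using J_near by blast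
      have "2 * r \<le> \<bar>of_int (int m) * \<alpha> - of_int \<lfloor>real m * \<alpha>\<rfloor>\<bar>"
        "2 * r \<le> \<bar>of_int (int m) * \<alpha> - of_int (\<lfloor>real m * \<alpha>\<rfloor> + 1)\<bar>"
        unfolding r(2) using m by (intro approx_int; simp)+
      then have "2 * r \<le> \<bar>z m\<bar>" "2 * r \<le> \<bar>z m - 1\<bar>" unfolding z_eq by (simp_all add: algebra_simps)
      moreover have "0 \<le> z m" "z m < 1" by (simp_all add: z_def frac_lt_1)
      ultimately show "y \<in> {0..<1}" using m(2) by auto
    qed
  qed (use J in auto)
qed

text \<open>If the permutation over \<open>y\<close> moves a label \<open>i\<close>, then
  \<open>(y, i)\<close> lies in tile \<open>i\<close> but not in its image. So the symmetric
  differences of the tiles cover the set of such \<open>y\<close>.\<close>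

lemma sum_measure_sym_diff_ge:
  assumes noncomm: "\<tau> \<circ> \<sigma> \<noteq> \<sigma> \<circ> \<tau>"
  shows "c / (4 * real d) \<le>
    (\<Sum>i\<in>{1..d}. measure M (sym_diff ((T ^^ q) ` ({0..<1} \<times> {i})) ({0..<1} \<times> {i})))"
proof -
  define D where "D i = sym_diff ((T ^^ q) ` ({0..<1} \<times> {i})) ({0..<1} \<times> {i})" for i
  have D: "D i \<in> sets M" if "i \<in> {1..d}" for i
    unfolding D_def by (intro sym_diff_sets tile_sets that)
  define S where "S i = (\<lambda>x. (x, i)) -` D i" for i
  have S: "S i \<in> lmeasurable" if "i \<in> {1..d}" for i
    unfolding S_def by (intro section_lmeasurable D that)
  obtain E where E: "E \<in> lmeasurable" "c / 4 \<le> measure lebesgue E" "E \<subseteq> {0..<1}"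
    "\<And>y. y \<in> E \<Longrightarrow> \<psi> q (y - real q * \<alpha>) \<noteq> id"
    using measure_cocycle_not_id[OF noncomm] by blast
  have "E \<subseteq> (\<Union>i\<in>{1..d}. S i)"
  proof
    fix y assume y: "y \<in> E"
    let ?f = "\<psi> q (y - real q * \<alpha>)"
    obtain i where i: "?f i \<noteq> i" using E(4)[OF y] by (auto simp: fun_eq_iff)
    then have i_mem: "i \<in> {1..d}" using permutes_cocycle permutes_not_in by metis
    have "(y, i) \<notin> (T ^^ q) ` ({0..<1} \<times> {i})"
      using i by (subst mem_funpow_square_tiled_iet_image[where S = UNIV]) auto
    then have "y \<in> S i" using y E(3) by (auto simp: S_def D_def)
    then show "y \<in> (\<Union>i\<in>{1..d}. S i)" using i_mem by blast
  qed
  then have "measure lebesgue E \<le> measure lebesgue (\<Union>i\<in>{1..d}. S i)"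
    using E(1) S by (intro measure_mono_fmeasurable fmeasurable.finite_UN) auto
  also have "\<dots> \<le> (\<Sum>i\<in>{1..d}. measure lebesgue (S i))"
    using S by (intro measure_UNION_le) auto
  also have "\<dots> \<le> (\<Sum>i\<in>{1..d}. real d * measure M (D i))"
  proof (rule sum_mono)
    fix i assume i: "i \<in> {1..d}"
    have "measure lebesgue (S i) \<le> (\<Sum>k\<in>{1..d}. measure lebesgue ((\<lambda>x. (x, k)) -` D i))"
      unfolding S_def using i by (intro member_le_sum) auto
    also have "\<dots> = real d * measure M (D i)"
      using d_ge_1 by (simp add: measure_iet_measure[OF d_ge_1 D[OF i]])
    finally show "measure lebesgue (S i) \<le> real d * measure M (D i)" .
  qed
  also have "\<dots> = real d * (\<Sum>i\<in>{1..d}. measure M (D i))" by (simp add: sum_distrib_left)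
  finally have "c / 4 \<le> real d * (\<Sum>i\<in>{1..d}. measure M (D i))" using E(2) by linarith
  then show ?thesis using d_ge_1 unfolding D_def by (simp add: field_simps)
qed

end

text \<open>The tiles are finitely many test sets, and the sum of their symmetric differences is
  bounded below independently of the time.\<close>

theorem not_rigid:
  assumes noncomm: "\<tau> \<circ> \<sigma> \<noteq> \<sigma> \<circ> \<tau>" and "c > 0"
    and "\<And>k (p::int). 1 \<le> k \<Longrightarrow> c / real k \<le> \<bar>real k * \<alpha> - of_int p\<bar>"
  shows "\<not> rigid M T"
proof
  assume "rigid M T"
  then obtain q :: "nat \<Rightarrow> nat" where q: "filterlim q at_top sequentially"
    and lim: "\<And>A. A \<in> sets M \<Longrightarrow> (\<lambda>n. measure M (sym_diff ((T ^^ q n) ` A) A)) \<longlonglongrightarrow> 0"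
    unfolding rigid_def by blast
  let ?s = "\<lambda>n. \<Sum>i\<in>{1..d}. measure M (sym_diff ((T ^^ q n) ` ({0..<1} \<times> {i})) ({0..<1} \<times> {i}))"
  have "?s \<longlonglongrightarrow> (\<Sum>i\<in>{1..d}. 0)"
    by (intro tendsto_sum lim tile_sets)
  moreover have "\<forall>\<^sub>F n in sequentially. c / (4 * real d) \<le> ?s n"
    using filterlim_at_top[THEN iffD1, OF q, rule_format, of 2]
    by eventually_elim (rule sum_measure_sym_diff_ge; use assms in blast)
  ultimately have "c / (4 * real d) \<le> (\<Sum>i\<in>{1..d}. 0 :: real)"
    by (rule tendsto_lowerbound) simp
  then show False using d_ge_1 assms(2) by (simp add: field_simps)
qed

section \<open>Unbounded partial quotients\<close>

context
  fixes q N :: nat and p :: int and t :: real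
  assumes t: "real q * \<alpha> = of_int p + t" "\<bar>t\<bar> < 1"
    and N: "\<And>f. f permutes {1..d} \<Longrightarrow> f ^^ N = id"
begin

text \<open>The points \<open>y\<close> whose backward orbit up to time \<open>N q\<close> comes within \<open>\<bar>t\<bar>\<close> of an integer.\<close>

definition near_returns :: "real set" where
  "near_returns = (\<Union>l\<in>{0..N * q}. \<Union>j\<in>{-1, 0, 1}.
     {frac (real l * \<alpha>) + j - \<bar>t\<bar> .. frac (real l * \<alpha>) + j + \<bar>t\<bar>})"

lemma lmeasurable_near_returns: "near_returns \<in> lmeasurable"
  unfolding near_returns_def by (intro fmeasurable.finite_UN) auto

lemma measure_near_returns: "measure lebesgue near_returns \<le> 6 * (real (N * q) + 1) * \<bar>t\<bar>"
proof -
  have "measure lebesgue near_returns \<le> (\<Sum>l\<in>{0..N * q}. \<Sum>j\<in>{-1, 0, 1 :: real}. 2 * \<bar>t\<bar>)"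
    unfolding near_returns_def
    by (intro order_trans[OF measure_UNION_le] sum_mono)
      (auto simp: measure_lebesgue_interval_real intro!: sets.finite_UN)
  also have "\<dots> = 6 * (real (N * q) + 1) * \<bar>t\<bar>" by (simp add: algebra_simps)
  finally show ?thesis .
qed

text \<open>\<open>y\<close> and the fractional part lie in [0, 1) and \<open>t\<close> is below 1
  in absolute value, so the integer offset is -1, 0 or 1.\<close>

lemma not_near_returns:
  assumes "y \<in> {0..<1}" "y \<notin> near_returns" "l \<le> N * q"
  shows "\<bar>t\<bar> < \<bar>y - real l * \<alpha> - of_int k\<bar>"
proof (rule ccontr)
  let ?f = "frac (real l * \<alpha>)" and ?j = "k + \<lfloor>real l * \<alpha>\<rfloor>"
  assume "\<not> ?thesis"
  then have le: "\<bar>y - ?f - of_int ?j\<bar> \<le> \<bar>t\<bar>" by (simp add: frac_def algebra_simps)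
  moreover have "0 \<le> ?f" "?f < 1" by (simp_all add: frac_lt_1)
  ultimately have "\<bar>of_int ?j :: real\<bar> < of_int 2" 
    using assms(1) t(2) unfolding atLeastLessThan_iff by linarith
  then have "\<bar>?j\<bar> < 2" by (simp only: of_int_abs[symmetric] of_int_less_iff)
  then have "?j \<in> {-1, 0, 1}" by auto
  then have j: "(of_int ?j :: real) \<in> {-1, 0, 1}" by auto
  have y: "y \<in> {?f + of_int ?j - \<bar>t\<bar> .. ?f + of_int ?j + \<bar>t\<bar>}"
    using le unfolding atLeastAtMost_iff by linarith
  have "y \<in> near_returns"
    unfolding near_returns_def
    by (rule UN_I[of l, rotated], rule UN_I, rule j, rule y) (simp add: assms(3))
  then show False using assms(2) by contradiction
qed

text \<open>Away from \<^term>\<open>near_returns\<close> the coding of the orbit is \<open>q\<close>-periodic up to time \<open>N q\<close>, so that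
  the permutation over it is an \<open>N\<close>-th power.\<close>

lemma cocycle_eq_id:
  assumes "y \<in> {0..<1}" "y \<notin> near_returns"
  shows "\<psi> (N * q) (y - real (N * q) * \<alpha>) = id"
proof -
  define x where "x = y - real (N * q) * \<alpha>"
  have period: "\<psi> q (x + real (l * q) * \<alpha>) = \<psi> q x" if "l < N" for l
    using that
  proof (induction l)
    case (Suc l)
    have "\<psi> q (x + real (Suc l * q) * \<alpha>) = \<psi> q (x + real (l * q) * \<alpha>)"
    proof (rule tile_cocycle_cong)
      fix k assume k: "k < q"
      \<comment> \<open>\<open>n\<close> is the time counted backward from \<open>y\<close>. Another
        \<open>q\<close> steps add \<open>t\<close> modulo 1; the perturbation lemma needs the times
        \<open>n\<close> and \<open>n - 1\<close>, hence the bound \<open>1 \<le> n\<close>.\<close>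
      define n where "n = N * q - (l * q + k)"
      have "Suc (Suc l) * q \<le> N * q" using Suc.prems by (intro mult_le_mono1) simp
      then have n: "1 \<le> n" "n \<le> N * q" "l * q + k \<le> N * q" using k by (auto simp: n_def)
      have "x + real (Suc l * q) * \<alpha> + real k * \<alpha> = (y - real n * \<alpha> + t) + of_int p"
        using n(3) t(1) by (simp add: x_def n_def of_nat_diff algebra_simps)
      then have "step (x + real (Suc l * q) * \<alpha> + real k * \<alpha>) = step (y - real n * \<alpha> + t)"
        by (simp only: tile_step_add_int)
      also have "\<dots> = step (y - real n * \<alpha>)"
      proof (rule step_perturb)
        fix p' :: int
        show "\<bar>t\<bar> < \<bar>y - real n * \<alpha> - of_int p'\<bar>"
          using n by (intro not_near_returns assms) auto
        have "\<bar>t\<bar> < \<bar>y - real (n - 1) * \<alpha> - of_int p'\<bar>"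
          using n by (intro not_near_returns assms) auto
        then show "\<bar>t\<bar> < \<bar>y - real n * \<alpha> + \<alpha> - of_int p'\<bar>"
          using n by (simp add: of_nat_diff algebra_simps)
      qed
      also have "y - real n * \<alpha> = x + real (l * q) * \<alpha> + real k * \<alpha>"
        using n(3) by (simp add: x_def n_def of_nat_diff algebra_simps)
      finally show "step (x + real (Suc l * q) * \<alpha> + real k * \<alpha>) =
          step (x + real (l * q) * \<alpha> + real k * \<alpha>)" .
    qed
    then show ?case using Suc by simp
  qed simp
  have "\<psi> (l * q) x = \<psi> q x ^^ l" if "l \<le> N" for l
    using that
  proof (induction l)
    case (Suc l)
    have "\<psi> (Suc l * q) x = \<psi> q (x + real (l * q) * \<alpha>) \<circ> \<psi> (l * q) x"
      using tile_cocycle_add[of \<tau> \<sigma> \<alpha> q "l * q" x] by simp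
    then show ?case using Suc period[of l] by simp
  qed simp
  from this[of N] show ?thesis using N[OF permutes_cocycle, of q x] by (simp add: x_def)
qed

text \<open>Away from \<open>near_returns\<close> labels are fixed and the iterate translates by
  \<open>s\<close> modulo 1. Wrapping around can occur only in the two end strips of width
  \<bar>s\<bar>.\<close>

lemma section_sym_diff_subset:
  assumes "A \<in> sets M"
  defines "s \<equiv> real N * t"
  shows "(\<lambda>x. (x, i)) -` sym_diff ((T ^^ (N * q)) ` A) A \<subseteq>
    (near_returns \<union> ({0..\<bar>s\<bar>} \<union> {1 - \<bar>s\<bar>..1})) \<union>
    sym_diff ((+) s ` ((\<lambda>x. (x, i)) -` A)) ((\<lambda>x. (x, i)) -` A)"
proof
  fix y assume y: "y \<in> (\<lambda>x. (x, i)) -` sym_diff ((T ^^ (N * q)) ` A) A"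
  note A = sets_M_subset[OF assms(1)]
  have iff: "(y, i) \<in> (T ^^ (N * q)) ` A \<longleftrightarrow> y \<in> {0..<1} \<and>
    (\<exists>k. (frac (y - real (N * q) * \<alpha>), k) \<in> A \<and> \<psi> (N * q) (y - real (N * q) * \<alpha>) k = i)"
    by (rule mem_funpow_square_tiled_iet_image[OF A])
  have y01: "y \<in> {0..<1}" using y A iff by auto
  show "y \<in> (near_returns \<union> ({0..\<bar>s\<bar>} \<union> {1 - \<bar>s\<bar>..1})) \<union>
    sym_diff ((+) s ` ((\<lambda>x. (x, i)) -` A)) ((\<lambda>x. (x, i)) -` A)"
  proof (cases "y \<in> near_returns \<or> y \<le> \<bar>s\<bar> \<or> 1 - \<bar>s\<bar> \<le> y")
    case True
    then show ?thesis using y01 by auto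
  next
    case False
    have "real (N * q) * \<alpha> = real N * (of_int p + t)" by (simp flip: t(1))
    then have "y - real (N * q) * \<alpha> = (y - s) + of_int (- (int N * p))"
      by (simp add: s_def algebra_simps)
    then have "frac (y - real (N * q) * \<alpha>) = frac (y - s)" by (simp only: frac_add_of_int_right)
    also have "\<dots> = y - s" using False by (subst frac_eq) linarith
    finally have "(y, i) \<in> (T ^^ (N * q)) ` A \<longleftrightarrow> (y - s, i) \<in> A"
      using False y01 by (simp add: iff cocycle_eq_id del: of_nat_mult)
    moreover have "(y - s, i) \<in> A \<longleftrightarrow> y \<in> (+) s ` ((\<lambda>x. (x, i)) -` A)"
      by (auto simp: image_iff intro!: bexI[of _ "y - s"])
    ultimately show ?thesis using y unfolding vimage_eq Un_iff Diff_iff by argo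
  qed
qed

text \<open>With w = N q \<bar>t\<bar>, near returns cost 6 w + 6 \<bar>t\<bar> and the end strips 2
  \<bar>s\<bar>; both \<bar>t\<bar> and \<bar>s\<bar> are at most w, which gives the constant
  14.\<close>

lemma measure_sym_diff_le:
  assumes A: "A \<in> sets M" and "q \<ge> 1" "N \<ge> 1"
    and e: "\<And>i. measure lebesgue (sym_diff ((+) (real N * t) ` ((\<lambda>x. (x, i)) -` A)) ((\<lambda>x. (x, i)) -` A)) \<le> e"
  shows "measure M (sym_diff ((T ^^ (N * q)) ` A) A) \<le> 14 * (real N * (real q * \<bar>t\<bar>)) + e"
proof -
  let ?D = "sym_diff ((T ^^ (N * q)) ` A) A"
  define s where "s = real N * t"
  have D: "?D \<in> sets M" by (intro sym_diff_sets A)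
  define w where "w = real N * (real q * \<bar>t\<bar>)"
  have "1 * \<bar>t\<bar> \<le> real q * \<bar>t\<bar>" by (rule mult_right_mono) (use assms(2) in simp_all)
  then have s_le: "\<bar>s\<bar> \<le> w" unfolding s_def w_def abs_mult by (simp add: mult_left_mono)
  have "1 * \<bar>t\<bar> \<le> real N * \<bar>t\<bar>" by (rule mult_right_mono) (use assms(3) in simp_all)
  then have t_le: "\<bar>t\<bar> \<le> w" using s_le by (simp add: s_def abs_mult)
  have "6 * (real (N * q) + 1) * \<bar>t\<bar> = 6 * w + 6 * \<bar>t\<bar>"
    by (simp add: w_def algebra_simps)
  then have near: "measure lebesgue near_returns \<le> 6 * w + 6 * \<bar>t\<bar>"
    using measure_near_returns by simp
  have bound: "measure lebesgue ((\<lambda>x. (x, i)) -` ?D) \<le> 14 * w + e" for i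
  proof -
    let ?A = "(\<lambda>x. (x, i)) -` A"
    have sym: "sym_diff ((+) s ` ?A) ?A \<in> lmeasurable"
      by (intro fmeasurable.Un fmeasurable.Diff measurable_translation section_lmeasurable A)
    have sec: "(\<lambda>x. (x, i)) -` ?D \<in> sets lebesgue"
      using section_lmeasurable[OF D] by (rule fmeasurableD)
    let ?I = "{0..\<bar>s\<bar>} \<union> {1 - \<bar>s\<bar>..1}" and ?S = "sym_diff ((+) s ` ?A) ?A"
    have I: "?I \<in> lmeasurable" by (intro fmeasurable.Un) simp_all
    note NI = fmeasurable.Un[OF lmeasurable_near_returns I]
    have "measure lebesgue ((\<lambda>x. (x, i)) -` ?D) \<le> measure lebesgue ((near_returns \<union> ?I) \<union> ?S)"
      using section_sym_diff_subset[OF A, folded s_def] sec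
        fmeasurable.Un[OF NI sym] by (rule measure_mono_fmeasurable)
    moreover have "measure lebesgue ((near_returns \<union> ?I) \<union> ?S)
        \<le> measure lebesgue (near_returns \<union> ?I) + measure lebesgue ?S"
      using NI sym by (intro measure_Un_le fmeasurableD)
    moreover have "measure lebesgue (near_returns \<union> ?I) \<le> measure lebesgue near_returns + measure lebesgue ?I"
      using lmeasurable_near_returns I by (intro measure_Un_le fmeasurableD)
    moreover have "measure lebesgue ?I \<le> measure lebesgue {0..\<bar>s\<bar>} + measure lebesgue {1 - \<bar>s\<bar>..1}"
      by (intro measure_Un_le) simp_all
    moreover have "measure lebesgue {0..\<bar>s\<bar>} = \<bar>s\<bar>" "measure lebesgue {1 - \<bar>s\<bar>..1} = \<bar>s\<bar>"
      by (subst measure_lebesgue_interval_real; simp)+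
    moreover have "measure lebesgue ?S \<le> e" using e[of i] by (simp only: s_def)
    ultimately show ?thesis using near s_le t_le by linarith
  qed
  have "(\<Sum>i\<in>{1..d}. measure lebesgue ((\<lambda>x. (x, i)) -` ?D)) \<le>
      (\<Sum>i\<in>{1..d}. 14 * w + e)"
    by (intro sum_mono bound)
  then have "measure M ?D \<le> 14 * w + e"
    using d_ge_1 by (simp add: measure_iet_measure[OF d_ge_1 D] field_simps)
  then show ?thesis by (simp only: w_def)
qed

end

text \<open>The rigidity times are \<open>N * q n\<close>: along good denominators
  \<open>q n\<close> both the exceptional measure and the shift \<open>N * t n\<close> tend to
  0.\<close>

theorem rigid_if_well_approximable:
  assumes "\<And>c K. c > 0 \<Longrightarrow> \<exists>q p. K < q \<and> real q * \<bar>real q * \<alpha> - of_int p\<bar> < c"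
  shows "rigid M T"
proof -
  obtain N where N: "N > 0" "\<And>f. f permutes {1..d} \<Longrightarrow> f ^^ N = id"
    using exists_common_permutation_order[of "{1..d}"] by auto
  have "\<exists>q p. n < q \<and> real q * \<bar>real q * \<alpha> - of_int p\<bar> < 1 / (real n + 1)" for n :: nat
    by (rule assms) simp
  then obtain q p where q: "\<And>n. n < q n"
    and qp: "\<And>n. real (q n) * \<bar>real (q n) * \<alpha> - of_int (p n)\<bar> < 1 / (real n + 1)"
    by metis
  define t where "t n = real (q n) * \<alpha> - of_int (p n)" for n
  have t_eq: "real (q n) * \<alpha> = of_int (p n) + t n" for n by (simp add: t_def)
  have q1: "1 \<le> q n" for n using q[of n] by simp
  have t_less: "\<bar>t n\<bar> < 1 / (real n + 1)" for n
  proof -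
    have "1 * \<bar>t n\<bar> \<le> real (q n) * \<bar>t n\<bar>" using q1[of n] by (intro mult_right_mono) auto
    then show ?thesis using qp[of n] by (simp add: t_def)
  qed
  have t1: "\<bar>t n\<bar> < 1" for n
  proof -
    have "1 / (real n + 1) \<le> 1" by simp
    then show ?thesis using t_less[of n] by linarith
  qed
  have lim: "(\<lambda>n. C * (1 / (real n + 1))) \<longlonglongrightarrow> 0" for C :: real
    using tendsto_mult_right_zero[OF LIMSEQ_inverse_real_of_nat, of C]
    by (simp add: inverse_eq_divide add.commute)
  have "(\<lambda>n. measure M (sym_diff ((T ^^ (N * q n)) ` A) A)) \<longlonglongrightarrow> 0" if A: "A \<in> sets M" for A
  proof (rule LIMSEQ_I)
    fix e :: real assume e: "e > 0"
    have "\<exists>\<delta>>0. \<forall>s. norm s < \<delta> \<longrightarrow>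
        measure lebesgue (sym_diff ((+) s ` ((\<lambda>x. (x, i)) -` A)) ((\<lambda>x. (x, i)) -` A)) \<le> e / 2" for i
      using measure_sym_diff_translation[OF fmeasurableD[OF section_lmeasurable[OF A]] section_bounded[OF A]]
        half_gt_zero[OF e] by metis
    then obtain \<delta> where \<delta>: "\<And>i. \<delta> i > 0" "\<And>i s. norm s < \<delta> i \<Longrightarrow>
        measure lebesgue (sym_diff ((+) s ` ((\<lambda>x. (x, i)) -` A)) ((\<lambda>x. (x, i)) -` A)) \<le> e / 2"
      by metis
    \<comment> \<open>One threshold for all labels; sections at labels outside the range are
      empty.\<close>
    define \<delta>' where "\<delta>' = Min (\<delta> ` {1..d})"
    have \<delta>': "\<delta>' > 0" "\<And>i. i \<in> {1..d} \<Longrightarrow> \<delta>' \<le> \<delta> i"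
      using \<delta>(1) d_ge_1 by (auto simp: \<delta>'_def)
    have small: "measure lebesgue (sym_diff ((+) s ` ((\<lambda>x. (x, i)) -` A)) ((\<lambda>x. (x, i)) -` A)) \<le> e / 2"
      if "norm s < \<delta>'" for s i
    proof (cases "i \<in> {1..d}")
      case True
      then show ?thesis using \<delta>(2) \<delta>'(2) that by (meson order_less_le_trans)
    next
      case False
      then have "(\<lambda>x. (x, i)) -` A = {}" using sets_M_subset[OF A] by auto
      then show ?thesis using e by simp
    qed
    have "\<forall>\<^sub>F n in sequentially. real N * (1 / (real n + 1)) < \<delta>'"
      using lim \<delta>'(1) by (rule order_tendstoD)
    moreover have "\<forall>\<^sub>F n in sequentially. 14 * real N * (1 / (real n + 1)) < e / 2"
      using lim[of "14 * real N"] e by (intro order_tendstoD(2)) auto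
    ultimately have "\<forall>\<^sub>F n in sequentially. norm (measure M (sym_diff ((T ^^ (N * q n)) ` A) A) - 0) < e"
    proof eventually_elim
      case (elim n)
      have "real N * \<bar>t n\<bar> \<le> real N * (1 / (real n + 1))"
        using t_less[of n] by (intro mult_left_mono) auto
      then have "norm (real N * t n) < \<delta>'" using elim(1) by (simp add: abs_mult)
      then have "measure M (sym_diff ((T ^^ (N * q n)) ` A) A) \<le>
          14 * (real N * (real (q n) * \<bar>t n\<bar>)) + e / 2"
        using N q1[of n] by (intro measure_sym_diff_le[OF t_eq t1 _ A] small) auto
      also have "real N * (real (q n) * \<bar>t n\<bar>) \<le> real N * (1 / (real n + 1))"
        using qp[of n] by (intro mult_left_mono) (auto simp: t_def)
      finally show ?case using elim(2) by simp
    qed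
    then show "\<exists>no. \<forall>n\<ge>no. norm (measure M (sym_diff ((T ^^ (N * q n)) ` A) A) - 0) < e"
      by (simp add: eventually_sequentially)
  qed
  moreover have "filterlim (\<lambda>n. N * q n) at_top sequentially"
  proof (rule filterlim_at_top_mono[OF filterlim_ident])
    have "n \<le> N * q n" for n
    proof -
      have "1 * q n \<le> N * q n" using N(1) by (intro mult_le_mono1) simp
      then show ?thesis using q[of n] by linarith
    qed
    then show "\<forall>\<^sub>F n in sequentially. n \<le> N * q n" by simp
  qed
  ultimately show ?thesis unfolding rigid_def by (intro exI[of _ "\<lambda>n. N * q n"]) blast
qed

end

section \<open>From genus and partial quotients to the permutation cocycle\<close>

theorem theorem2:
  fixes d :: nat and \<tau> \<sigma> :: "nat \<Rightarrow> nat" and \<alpha> :: real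
  assumes "tiling_data d \<tau> \<sigma>"
    and "connected_space (square_tiled_surface d \<tau> \<sigma>)"
    and "surface_genus d \<tau> \<sigma> \<ge> 2"
    and "0 < \<alpha>" and "\<alpha> < 1" and "\<alpha> \<notin> \<rat>"
  shows "rigid (iet_measure d) (square_tiled_iet \<tau> \<sigma> \<alpha>) \<longleftrightarrow> \<not> bounded_partial_quotients \<alpha>"
proof -
  interpret tiled_rotation d \<tau> \<sigma> \<alpha>
    using assms(1,4,5) by unfold_locales
  have noncomm: "\<tau> \<circ> \<sigma> \<noteq> \<sigma> \<circ> \<tau>"
  proof
    assume "\<tau> \<circ> \<sigma> = \<sigma> \<circ> \<tau>"
    then have "surface_genus d \<tau> \<sigma> \<le> 1"
      by (intro surface_genus_commute assms) (auto dest: fun_cong)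
    then show False using assms(3) by simp
  qed
  show ?thesis
  \<comment> \<open>For irrational \<alpha> this is the condition on partial quotients, so each case
    decides both sides of the equivalence.\<close>
  proof (cases "badly_approximable \<alpha>")
    case True
    then obtain c where "c > 0"
      "\<And>k (p::int). 1 \<le> k \<Longrightarrow> c / real k \<le> \<bar>real k * \<alpha> - of_int p\<bar>"
      unfolding badly_approximable_def by blast
    then have "\<not> rigid (iet_measure d) (square_tiled_iet \<tau> \<sigma> \<alpha>)"
      by (rule not_rigid[OF noncomm])
    then show ?thesis
      using True assms(6) by (simp add: bounded_partial_quotients_iff_badly_approximable)
  next
    case False
    have "rigid (iet_measure d) (square_tiled_iet \<tau> \<sigma> \<alpha>)"
    proof (rule rigid_if_well_approximable)
      fix c :: real and K :: nat assume "c > 0"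
      then show "\<exists>q p. K < q \<and> real q * \<bar>real q * \<alpha> - of_int p\<bar> < c"
        using not_badly_approximable_arbitrarily_large[OF assms(6) False] by metis
    qed
    then show ?thesis
      using False assms(6) by (simp add: bounded_partial_quotients_iff_badly_approximable)
  qed
qed

end
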